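(* Let $\mathcal C$ be a plane curve over $\mathbb C$ defined by an irreducible polynomial $f\in\mathbb R[x,y]$, such that $(0:1:0)$ is not an infinity point of $\mathcal C$, and let $P=(1:m:0)$ be a regular infinity point of $\mathcal C$. Let $B$ be an infinity branch of $\mathcal C$ associated to $P$, given by $$r(z)=mz+a_1z^{1-n_1/n}+\cdots+a_kz^{1-n_k/n}+A(z),$$ where $a_1,\dots,a_k\in\mathbb C\setminus\{0\}$, $n,n_i\in\mathbb N$, $0<n_1<\cdots<n_k\le n$, $\gcd(n,n_1,\dots,n_k)=1$ and $A(z)$ collects all terms of $r(z)$ with negative exponent. Let $\widetilde{\mathcal C}$ be the asymptote of $\mathcal C$ at $B$ given by the parametrization $(t^n,\;mt^n+a_1t^{n-n_1}+\cdots+a_kt^{n-n_k})$. Then: 1. $P$ is a regular point of (the projective closure of) $\widetilde{\mathcal C}$. 2. The asymptotes of $\mathcal C$ at $B$ are exactly the curves in the proximity class of $\widetilde{\mathcal C}$.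
   Context: Curves. A plane curve over $\mathbb C$ is the zero set in $\mathbb C^2$ of an irreducible polynomial $f\in\mathbb C[x,y]$ of degree $d\ge 1$; $d$ is the degree of the curve. Write $f=f_d+f_{d-1}+\cdots+f_0$ with $f_i$ homogeneous of degree $i$, and $F(x,y,z)=f_d+zf_{d-1}+\cdots+z^df_0$ for the polynomial of its projective closure. The infinity points are the points $(a:b:0)$ with $f_d(a,b)=0$. An infinity point is regular if it is a non-singular point of the projective closure. Infinity branches. Let $\mathcal C$ be a curve and $(1:m:0)$, $m\in\mathbb C$, an infinity point. Put $g(y,z)=F(1,y,z)$. Let $\varphi(z)=m+a_1z^{N_1/N}+a_2z^{N_2/N}+\cdots$ (finitely or infinitely many terms, $a_i\ne0$, $N,N_i\in\mathbb N$, $0<N_1<N_2<\cdots$) be a Puiseux series with $g(\varphi(z),z)=0$ and ramification index $N$ (the least common denominator of its exponents). Its conjugates are $\varphi_j(z)=m+a_1c_j^{N_1}z^{N_1/N}+a_2c_j^{N_2}z^{N_2/N}+\cdots$, where $c_1,\dots,c_N$ are the $N$-th roots of unity. Put $r_j(z)=z\varphi_j(z^{-1})=mz+a_1c_j^{N_1}z^{1-N_1/N}+\cdots$, which converges for $|z|>M$ for some $M>0$. The set $B=\bigcup_{j=1}^N L_j$, with leaves $L_j=\{(z,r_j(z))\in\mathbb C^2: |z|>M\}$, is an infinity branch of $\mathcal C$ associated to $(1:m:0)$. It is determined, up to conjugation, by any one series $r=r_j$, and one says that $B$ is given by $r$. Approaching curves. Let $d(p,\overline{\mathcal C})$ be the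 usual distance in $\mathbb C^2$ from a point $p$ to a curve $\overline{\mathcal C}$. A curve $\overline{\mathcal C}$ approaches $\mathcal C$ at its infinity branch $B$ if there is a leaf $\{(z,r(z)):|z|>M\}\subset B$ with $\lim_{z\to\infty}d((z,r(z)),\overline{\mathcal C})=0$. Perfect curves and asymptotes. A curve of degree $d$ (not having $(0:1:0)$ as infinity point) is perfect if it cannot be approached, at any of its infinity branches, by any curve over $\mathbb C$ of degree less than $d$. An asymptote of $\mathcal C$ at $B$ is a perfect curve that approaches $\mathcal C$ at $B$. Proximity class. A perfect curve has exactly one infinity branch, and "approaching" is an equivalence relation on the set of perfect curves. The proximity class of a perfect curve $\mathcal D$ is the set of all perfect curves that approach $\mathcal D$. *)

theory Defs
  imports
    "HOL-Analysis.Analysis"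
    "HOL-Computational_Algebra.Computational_Algebra"
begin

section \<open>Plane curves\<close>

text \<open>
  A polynomial in \<open>\<complex>[x,y]\<close> is an element of \<open>\<complex>[x][y]\<close>: the coefficient of
  \<open>x\<^sup>i y\<^sup>j\<close> in \<open>f\<close> is \<open>coeff (coeff f j) i\<close>.
\<close>

definition eval2 :: "complex poly poly \<Rightarrow> complex \<Rightarrow> complex \<Rightarrow> complex" where
  "eval2 f x y = poly (poly f [:y:]) x"

definition zero_set :: "complex poly poly \<Rightarrow> (complex \<times> complex) set" where
  "zero_set f = {(x, y). eval2 f x y = 0}"

definition total_degree :: "complex poly poly \<Rightarrow> nat" where
  "total_degree f = Max {i + j |i j. coeff (coeff f j) i \<noteq> 0}"

text \<open>
  A plane curve is the zero set of an irreducible polynomial (which is non-constant,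
  since the non-zero constants are units). The zero set determines the polynomial up
  to a non-zero constant, and the notions below do not change under such a rescaling.
  Hence it does not matter which defining polynomial a definition picks.
\<close>

definition defines_curve :: "complex poly poly \<Rightarrow> (complex \<times> complex) set \<Rightarrow> bool" where
  "defines_curve f C \<longleftrightarrow> irreducible f \<and> C = zero_set f"

section \<open>Projective closure and points at infinity\<close>

definition hom_part :: "complex poly poly \<Rightarrow> nat \<Rightarrow> complex poly poly" where
  "hom_part f e = (\<Sum>i\<le>e. monom (monom (coeff (coeff f (e - i)) i) i) (e - i))"

text \<open>The homogenization lives in \<open>\<complex>[x][y][z]\<close>; the coefficient of \<open>z\<^sup>k\<close> is \<open>f\<^bsub>d-k\<^esub>\<close>.\<close>

definition homogenization :: "complex poly poly \<Rightarrow> complex poly poly poly" where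
  "homogenization f = (\<Sum>k\<le>total_degree f. monom (hom_part f (total_degree f - k)) k)"

definition eval3 :: "complex poly poly poly \<Rightarrow> complex \<Rightarrow> complex \<Rightarrow> complex \<Rightarrow> complex" where
  "eval3 F x y z = eval2 (poly F [:[:z:]:]) x y"

definition infinity_point :: "complex poly poly \<Rightarrow> complex \<Rightarrow> complex \<Rightarrow> bool" where
  "infinity_point f a b \<longleftrightarrow> (a, b) \<noteq> (0, 0) \<and> eval2 (hom_part f (total_degree f)) a b = 0"

text \<open>The three derivatives are those with respect to \<open>x\<close>, \<open>y\<close> and \<open>z\<close>.\<close>

definition regular_infinity_point :: "complex poly poly \<Rightarrow> complex \<Rightarrow> complex \<Rightarrow> bool" where
  "regular_infinity_point f a b \<longleftrightarrow> infinity_point f a b \<and>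
     (eval3 (map_poly (map_poly pderiv) (homogenization f)) a b 0 \<noteq> 0 \<or>
      eval3 (map_poly pderiv (homogenization f)) a b 0 \<noteq> 0 \<or>
      eval3 (pderiv (homogenization f)) a b 0 \<noteq> 0)"

section \<open>Infinity branches\<close>

text \<open>
  A Puiseux series with exponents in \<open>(1/N)\<nat>\<close> is a formal power series \<open>\<phi>\<close> in
  \<open>s = z\<^bsup>1/N\<^esup>\<close>, so that \<open>fps_nth \<phi> k\<close> is the coefficient of \<open>z\<^bsup>k/N\<^esup>\<close>. The following
  is the formal series \<open>F(1, \<phi>, z) = g(\<phi>, z)\<close>, where \<open>z = s\<^sup>N\<close>.
\<close>

definition subst_puiseux :: "complex poly poly \<Rightarrow> nat \<Rightarrow> complex fps \<Rightarrow> complex fps" where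
  "subst_puiseux f N \<phi> =
     poly (map_poly (\<lambda>q. poly (map_poly (\<lambda>p. fps_const (poly p 1)) q) \<phi>) (homogenization f))
       (fps_X ^ N)"

text \<open>
  The gcd condition says that \<open>N\<close> is the least common denominator of the exponents. The
  radius of convergence is positive for every solution of the equation; it is recorded
  here because \<open>r\<close> is required to converge for \<open>|z| > M\<close>, for some \<open>M > 0\<close>.
\<close>

definition puiseux_solution :: "complex poly poly \<Rightarrow> complex \<Rightarrow> nat \<Rightarrow> complex fps \<Rightarrow> bool" where
  "puiseux_solution f m N \<phi> \<longleftrightarrow>
     N > 0 \<and> fps_nth \<phi> 0 = m \<and> Gcd (insert N {k. fps_nth \<phi> k \<noteq> 0}) = 1 \<and>
     subst_puiseux f N \<phi> = 0 \<and> fps_conv_radius \<phi> > 0"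

text \<open>
  \<open>r_leaf N \<phi> c\<close> is \<open>r\<^sub>j(z) = z \<phi>\<^sub>j(1/z)\<close> for the root of unity \<open>c = c\<^sub>j\<close>, with the principal
  determination of the \<open>N\<close>-th root. An infinity branch is represented by the set of the
  functions \<open>r\<^sub>1, \<dots>, r\<^sub>N\<close> whose graphs over \<open>|z| > M\<close> are its leaves. The values of these
  functions for small \<open>|z|\<close> are irrelevant, as only limits at infinity are taken.
\<close>

definition r_leaf :: "nat \<Rightarrow> complex fps \<Rightarrow> complex \<Rightarrow> complex \<Rightarrow> complex" where
  "r_leaf N \<phi> c z = z * eval_fps \<phi> (c * inverse z powr (1 / of_nat N))"

definition branch_of :: "nat \<Rightarrow> complex fps \<Rightarrow> (complex \<Rightarrow> complex) set" where
  "branch_of N \<phi> = {r_leaf N \<phi> c |c. c ^ N = 1}"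

definition infinity_branch :: "(complex \<times> complex) set \<Rightarrow> (complex \<Rightarrow> complex) set \<Rightarrow> bool" where
  "infinity_branch C B \<longleftrightarrow>
     (\<exists>f m N \<phi>. defines_curve f C \<and> puiseux_solution f m N \<phi> \<and> B = branch_of N \<phi>)"

text \<open>The coefficient of \<open>z\<^sup>q\<close> in the series \<open>r(z) = z \<phi>(1/z)\<close>.\<close>

definition r_coeff :: "nat \<Rightarrow> complex fps \<Rightarrow> rat \<Rightarrow> complex" where
  "r_coeff N \<phi> q =
     (if (1 - q) * of_nat N \<in> \<nat> then fps_nth \<phi> (nat \<lfloor>(1 - q) * of_nat N\<rfloor>) else 0)"

section \<open>Approaching curves, perfect curves, asymptotes\<close>

definition approaches_at :: "(complex \<times> complex) set \<Rightarrow> (complex \<Rightarrow> complex) set \<Rightarrow> bool" where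
  "approaches_at D B \<longleftrightarrow> (\<exists>r\<in>B. ((\<lambda>z. infdist (z, r z) D) \<longlongrightarrow> 0) at_infinity)"

definition approaches :: "(complex \<times> complex) set \<Rightarrow> (complex \<times> complex) set \<Rightarrow> bool" where
  "approaches D C \<longleftrightarrow> (\<exists>B. infinity_branch C B \<and> approaches_at D B)"

definition perfect_curve :: "(complex \<times> complex) set \<Rightarrow> bool" where
  "perfect_curve D \<longleftrightarrow>
     (\<exists>f. defines_curve f D \<and> \<not> infinity_point f 0 1 \<and>
        \<not> (\<exists>E h B. defines_curve h E \<and> total_degree h < total_degree f \<and>
             infinity_branch D B \<and> approaches_at E B))"

definition asymptote :: "(complex \<times> complex) set \<Rightarrow> (complex \<times> complex) set
    \<Rightarrow> (complex \<Rightarrow> complex) set \<Rightarrow> bool" where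
  "asymptote D C B \<longleftrightarrow> infinity_branch C B \<and> perfect_curve D \<and> approaches_at D B"

definition proximity_class :: "(complex \<times> complex) set \<Rightarrow> (complex \<times> complex) set set" where
  "proximity_class D = {E. perfect_curve E \<and> approaches E D}"

end

theory Submission
  imports Defs "HOL-Complex_Analysis.Laurent_Convergence"
begin

text \<open>
  At a regular point \<open>(1:m:0)\<close> one of \<open>F\<^sub>y\<close>, \<open>F\<^sub>z\<close> does not vanish. If \<open>F\<^sub>y \<noteq> 0\<close> the branch is unramified; if
  \<open>F\<^sub>z \<noteq> 0\<close> then \<open>z\<close> is a function of \<open>y\<close> and \<open>\<phi>\<close> starts with \<open>m + a z\<^bsup>1/N\<^esup>\<close>, \<open>a \<noteq> 0\<close>. In both cases \<open>n = N\<close>, and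
  the truncated series \<open>\<psi>(s) = m + \<dots>\<close> in \<open>s = z\<^bsup>1/n\<^esup>\<close> satisfies \<open>n = 1\<close> or \<open>\<psi>'(0) \<noteq> 0\<close>. The norm
  \<open>\<Prod>\<^sub>c (y - \<rho>(c t))\<close> over the \<open>n\<close>-th roots of unity \<open>c\<close> is then an irreducible equation of degree \<open>n\<close> for the
  curve \<open>(t\<^sup>n, \<rho>(t))\<close>, \<open>\<rho>(t) = t\<^sup>n \<psi>(1/t)\<close>, and its homogenization restricts to \<open>F(1, y, s\<^sup>n) = \<Prod>\<^sub>c (y - \<psi>(c s))\<close>, whose
  linear terms give regularity. This product also shows that every leaf of the curve is
  \<open>z \<psi>(c z\<^bsup>-1/n\<^esup>)\<close> for some \<open>c\<close>; it differs from the leaf \<open>z \<phi>(c z\<^bsup>-1/n\<^esup>)\<close> of \<open>B\<close> by a function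
  tending to \<open>0\<close>. Hence a curve approaches one exactly if it approaches the other.
\<close>

section \<open>Homogeneous parts and evaluation\<close>

lemma eval2_conv_map_poly: "eval2 f x y = poly (map_poly (\<lambda>p. poly p x) f) y"
  unfolding eval2_def by (induction f rule: pCons_induct) (simp_all add: map_poly_pCons)

lemma eval2_add: "eval2 (f + g) x y = eval2 f x y + eval2 g x y"
  and eval2_0: "eval2 0 x y = 0"
  and eval2_monom: "eval2 (monom (monom c i) j) x y = c * x ^ i * y ^ j"
  by (simp_all add: eval2_def poly_monom)

lemma eval2_sum: "eval2 (sum f A) x y = (\<Sum>i\<in>A. eval2 (f i) x y)"
  by (induction A rule: infinite_finite_induct) (simp_all add: eval2_add eval2_0)

lemma eval2_hom_part:
  "eval2 (hom_part f e) x y = (\<Sum>i\<le>e. coeff (coeff f (e - i)) i * x ^ i * y ^ (e - i))"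
  by (simp add: hom_part_def eval2_sum eval2_monom)

lemma coeff_hom_part:
  "coeff (coeff (hom_part f e) j) i = (if i + j = e then coeff (coeff f j) i else 0)"
proof -
  have "coeff (coeff (hom_part f e) j) i =
      (\<Sum>i'\<le>e. if i' = i then (if e - i = j then coeff (coeff f (e - i)) i else 0) else 0)"
    unfolding hom_part_def coeff_sum by (intro sum.cong) auto
  also have "\<dots> = (if i + j = e then coeff (coeff f j) i else 0)"
    by auto
  finally show ?thesis .
qed

lemma total_degree_finite: "finite {i + j |i j. coeff (coeff f j) i \<noteq> (0::complex)}"
proof -
  let ?D = "Max ((\<lambda>j. degree (coeff f j)) ` {..degree f})"
  have "{i + j |i j. coeff (coeff f j) i \<noteq> 0} \<subseteq> (\<lambda>(i, j). i + j) ` ({..?D} \<times> {..degree f})"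
  proof safe
    fix i j assume *: "coeff (coeff f j) i \<noteq> 0"
    then have j: "j \<le> degree f" by (intro le_degree) auto
    have "i \<le> degree (coeff f j)" using * by (rule le_degree)
    also have "\<dots> \<le> ?D" using j by (intro Max_ge) auto
    finally show "i + j \<in> (\<lambda>(i, j). i + j) ` ({..?D} \<times> {..degree f})" using j by force
  qed
  then show ?thesis by (rule finite_subset) auto
qed

lemma le_total_degree: "coeff (coeff f j) i \<noteq> 0 \<Longrightarrow> i + j \<le> total_degree f"
  unfolding total_degree_def by (rule Max_ge[OF total_degree_finite]) auto

lemma total_degree_eqI:
  assumes "\<And>i j. coeff (coeff f j) i \<noteq> 0 \<Longrightarrow> i + j \<le> d"
    and "coeff (coeff f j) i \<noteq> 0" "i + j = d"
  shows "total_degree f = d"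
  unfolding total_degree_def by (rule Max_eqI[OF total_degree_finite]) (use assms in auto)

lemma sum_hom_part: "(\<Sum>e\<le>total_degree f. hom_part f e) = f"
proof (intro poly_eqI)
  fix i j
  have "coeff (coeff (\<Sum>e\<le>total_degree f. hom_part f e) j) i =
      (\<Sum>e\<le>total_degree f. if e = i + j then coeff (coeff f j) i else 0)"
    unfolding coeff_sum coeff_hom_part by (intro sum.cong) auto
  also have "\<dots> = coeff (coeff f j) i"
    using le_total_degree[of f j i] by auto
  finally show "coeff (coeff (\<Sum>e\<le>total_degree f. hom_part f e) j) i = coeff (coeff f j) i" .
qed

lemma eval2_hom_part_scale:
  "eval2 (hom_part f e) (t * x) (t * y) = t ^ e * eval2 (hom_part f e) x y"
proof -
  have "t ^ i * t ^ (e - i) = t ^ e" if "i \<le> e" for i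
    using that by (simp flip: power_add)
  then show ?thesis
    unfolding eval2_hom_part sum_distrib_left
    by (intro sum.cong refl) (simp add: power_mult_distrib mult_ac)
qed

lemma coeff_homogenization:
  "coeff (homogenization f) k = (if k \<le> total_degree f then hom_part f (total_degree f - k) else 0)"
  unfolding homogenization_def coeff_sum by (simp add: coeff_monom)

lemma eval3_homogenization:
  "eval3 (homogenization f) x y z =
     (\<Sum>k\<le>total_degree f. eval2 (hom_part f (total_degree f - k)) x y * z ^ k)"
proof -
  have "poly (poly (q * [:[:z:]:] ^ k) [:y:]) x = eval2 q x y * z ^ k" for q k
    by (simp add: eval2_def)
  then show ?thesis
    by (simp add: eval3_def homogenization_def eval2_def poly_sum poly_monom)
qed

lemma eval3_at_0: "eval3 F x y 0 = eval2 (coeff F 0) x y"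
  by (simp add: eval3_def poly_0_coeff_0)

text \<open>The part of degree e scales by z^(-e), and the factor z^d turns this into z^(d-e). This
  links the chart at infinity with the affine zero set.\<close>

lemma eval3_homogenization_dehom:
  assumes "z \<noteq> 0"
  shows "eval3 (homogenization f) 1 y z = z ^ total_degree f * eval2 f (1 / z) (y / z)"
proof -
  let ?d = "total_degree f"
  have "eval2 f (1 / z) (y / z) = (\<Sum>e\<le>?d. eval2 (hom_part f e) (1 / z * 1) (1 / z * y))"
    by (subst (1) sum_hom_part[symmetric]) (simp add: eval2_sum)
  also have "\<dots> = (\<Sum>e\<le>?d. (1 / z) ^ e * eval2 (hom_part f e) 1 y)"
    by (simp only: eval2_hom_part_scale)
  also have "\<dots> = (\<Sum>k\<le>?d. (1 / z) ^ (?d - k) * eval2 (hom_part f (?d - k)) 1 y)"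
    by (rule sum.reindex_bij_witness[of _ "\<lambda>k. ?d - k" "\<lambda>k. ?d - k"]) auto
  finally have "z ^ ?d * eval2 f (1 / z) (y / z) =
      (\<Sum>k\<le>?d. z ^ ?d * (1 / z) ^ (?d - k) * eval2 (hom_part f (?d - k)) 1 y)"
    by (simp add: sum_distrib_left mult.assoc)
  also have "\<dots> = (\<Sum>k\<le>?d. eval2 (hom_part f (?d - k)) 1 y * z ^ k)"
  proof (intro sum.cong refl)
    fix k assume "k \<in> {..?d}"
    then have "z ^ ?d = z ^ k * z ^ (?d - k)" by (simp flip: power_add)
    with assms show "z ^ ?d * (1 / z) ^ (?d - k) * eval2 (hom_part f (?d - k)) 1 y =
        eval2 (hom_part f (?d - k)) 1 y * z ^ k"
      by (simp add: power_one_over)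
  qed
  finally show ?thesis by (simp add: eval3_homogenization)
qed

text \<open>Euler's relation makes the \<open>x\<close>-derivative redundant at the point \<open>(1:m:0)\<close>.\<close>

lemma regular_infinity_point_iff:
  "regular_infinity_point f 1 m \<longleftrightarrow>
     eval2 (hom_part f (total_degree f)) 1 m = 0 \<and>
     (eval2 (pderiv (hom_part f (total_degree f))) 1 m \<noteq> 0 \<or>
      eval2 (coeff (homogenization f) 1) 1 m \<noteq> 0)"
proof -
  let ?d = "total_degree f" and ?g = "hom_part f (total_degree f)"
  have x: "eval2 (map_poly pderiv ?g) 1 m =
      (\<Sum>i\<le>?d. of_nat i * coeff (coeff f (?d - i)) i * m ^ (?d - i))"
  proof -
    have "map_poly pderiv ?g = (\<Sum>i\<le>?d. monom (pderiv (monom (coeff (coeff f (?d - i)) i) i)) (?d - i))"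
      unfolding hom_part_def
      by (intro poly_eqI)
        (auto simp: coeff_map_poly coeff_sum coeff_pderiv coeff_monom sum_distrib_left simp del: of_nat_Suc
          intro!: sum.cong)
    then show ?thesis
      by (simp add: eval2_sum pderiv_monom eval2_monom)
  qed
  have y: "eval2 (pderiv ?g) 1 m =
      (\<Sum>i\<le>?d. of_nat (?d - i) * coeff (coeff f (?d - i)) i * m ^ (?d - i - 1))"
  proof -
    have "pderiv ?g = (\<Sum>i\<le>?d. pderiv (monom (monom (coeff (coeff f (?d - i)) i) i) (?d - i)))"
      unfolding hom_part_def
      by (intro poly_eqI) (auto simp: coeff_sum coeff_pderiv sum_distrib_left simp del: of_nat_Suc)
    then show ?thesis
      by (simp add: pderiv_monom eval2_def poly_sum poly_monom mult_ac)
  qed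
  \<comment> \<open>The factor \<open>of_nat k\<close> covers k = 0, where natural subtraction makes
    \<open>k - 1\<close> equal to 0.\<close>
  have m: "of_nat k * m ^ (k - 1) * m = of_nat k * m ^ k" for k
    by (cases k) auto
  have "eval2 (map_poly pderiv ?g) 1 m + eval2 (pderiv ?g) 1 m * m =
      (\<Sum>i\<le>?d. of_nat i * coeff (coeff f (?d - i)) i * m ^ (?d - i) +
         coeff (coeff f (?d - i)) i * (of_nat (?d - i) * m ^ (?d - i - 1) * m))"
    unfolding x y sum_distrib_right sum.distrib[symmetric] by (simp add: mult_ac)
  also have "\<dots> = (\<Sum>i\<le>?d. of_nat ?d * (coeff (coeff f (?d - i)) i * m ^ (?d - i)))"
    unfolding m by (intro sum.cong refl) (simp add: of_nat_diff algebra_simps)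
  also have "\<dots> = of_nat ?d * eval2 ?g 1 m"
    by (simp add: eval2_hom_part sum_distrib_left)
  finally have euler: "eval2 (map_poly pderiv ?g) 1 m + eval2 (pderiv ?g) 1 m * m =
      of_nat ?d * eval2 ?g 1 m" .
  show ?thesis
    unfolding regular_infinity_point_def infinity_point_def
    by (use euler in \<open>auto simp: eval3_at_0 coeff_map_poly coeff_homogenization coeff_pderiv\<close>)
qed

section \<open>Formal solutions\<close>

lemma map_poly_hom_mult:
  fixes h :: "'a::comm_semiring_0 \<Rightarrow> 'b::comm_semiring_0"
  assumes "h 0 = 0" "\<And>x y. h (x + y) = h x + h y" "\<And>x y. h (x * y) = h x * h y"
  shows "map_poly h (p * q) = map_poly h p * map_poly h q"
proof (rule poly_eqI)
  fix i
  have "h (sum g A) = (\<Sum>i\<in>A. h (g i))" for g :: "nat \<Rightarrow> 'a" and A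
    by (induction A rule: infinite_finite_induct) (simp_all add: assms)
  then show "coeff (map_poly h (p * q)) i = coeff (map_poly h p * map_poly h q) i"
    by (simp add: coeff_map_poly coeff_mult assms)
qed

lemma poly_map_poly_hom:
  fixes h :: "'a::comm_semiring_0 \<Rightarrow> 'b::comm_semiring_0"
  assumes "h 0 = 0" "\<And>x y. h (x + y) = h x + h y" "\<And>x y. h (x * y) = h x * h y"
  shows "poly (map_poly h p) (h x) = h (poly p x)"
  by (induction p rule: pCons_induct) (simp_all add: assms map_poly_pCons)

lemma pderiv_map_poly_fps_const:
  "pderiv (map_poly fps_const p) = map_poly fps_const (pderiv p)"
proof (rule poly_eqI)
  fix i
  have "fps_const (of_nat (Suc i) * coeff p (Suc i)) = of_nat (Suc i) * fps_const (coeff p (Suc i))"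
    by (metis fps_const_mult fps_of_nat)
  then show "coeff (pderiv (map_poly fps_const p)) i = coeff (map_poly fps_const (pderiv p)) i"
    by (simp add: coeff_pderiv coeff_map_poly)
qed

text \<open>Taking the constant term is a ring homomorphism, so equations over power series can be
  reduced modulo s.\<close>

lemma poly_fps_nth_0:
  "fps_nth (poly P v) 0 = poly (map_poly (\<lambda>F. fps_nth F 0) P) (fps_nth v 0)"
  for v :: "complex fps"
  by (rule poly_map_poly_hom[symmetric]) auto

lemma poly_map_poly_fps_const_nth_0:
  "fps_nth (poly (map_poly fps_const p) v) 0 = poly p (fps_nth v 0)" for v :: "complex fps"
  by (simp add: poly_fps_nth_0 map_poly_map_poly o_def)

text \<open>Uniqueness half of Hensel's lemma. In P = (Y - v) R the value R(v) is P'(v), a unit;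
  R(v') has the same constant term, so v' - v must vanish.\<close>

lemma fps_poly_root_unique:
  fixes v v' :: "complex fps"
  assumes "poly P v = 0" "poly P v' = 0" "fps_nth v 0 = fps_nth v' 0"
    and "fps_nth (poly (pderiv P) v) 0 \<noteq> 0"
  shows "v = v'"
proof -
  obtain R where R: "P = [:-v, 1:] * R"
    using assms(1) by (metis dvdE poly_eq_0_iff_dvd)
  have "poly P v' = (v' - v) * poly R v'" by (simp add: R algebra_simps)
  with assms(2) have "(v' - v) * poly R v' = 0" by simp
  moreover have "fps_nth (poly R v') 0 \<noteq> 0"
  proof -
    have "poly (pderiv P) v = poly R v" 
      unfolding R pderiv_mult by (simp add: pderiv_pCons)
    with assms(3,4) show ?thesis by (simp add: poly_fps_nth_0)
  qed
  ultimately show ?thesis by (metis eq_iff_diff_eq_0 fps_zero_nth mult_eq_0_iff)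
qed

text \<open>Otherwise all n roots of unity would solve X^r = 1 with 0 < r = k mod n < n. This turns
  invariance under s -> c s into divisibility of exponents.\<close>

lemma dvd_if_roots_unity:
  assumes "n > 0" and "\<And>c :: complex. c ^ n = 1 \<Longrightarrow> c ^ k = 1"
  shows "n dvd k"
proof (rule ccontr)
  assume "\<not> n dvd k"
  then have r: "k mod n > 0" by (simp add: mod_greater_zero_iff_not_dvd)
  have "{c::complex. c ^ n = 1} \<subseteq> {c. c ^ (k mod n) = 1}"
  proof clarify
    fix c :: complex assume c: "c ^ n = 1"
    have "c ^ k = c ^ (k mod n) * (c ^ n) ^ (k div n)"
      by (metis mod_mult_div_eq power_add power_mult)
    with c assms(2)[OF c] show "c ^ (k mod n) = 1" by simp
  qed
  from card_mono[OF finite_roots_unity this] have "n \<le> k mod n"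
    using r assms(1) by (simp add: card_roots_unity_eq)
  with assms(1) show False by (meson mod_less_divisor not_le)
qed

text \<open>With g(y,z) = F(1,y,z) written as the sum of g_k(y) z^k, this is g_k. An infinity point
  (1:m:0) is regular exactly if g_0'(m) or g_1(m) is nonzero.\<close>

definition dehom_part :: "complex poly poly \<Rightarrow> nat \<Rightarrow> complex poly" where
  "dehom_part f k = map_poly (\<lambda>p. poly p 1) (coeff (homogenization f) k)"

lemma poly_dehom_part: "poly (dehom_part f k) y = eval2 (coeff (homogenization f) k) 1 y"
  by (simp add: dehom_part_def eval2_conv_map_poly)

lemma subst_puiseux_eq_sum:
  "subst_puiseux f N \<phi> =
     (\<Sum>k\<le>total_degree f. poly (map_poly fps_const (dehom_part f k)) \<phi> * fps_X ^ (N * k))"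
proof -
  let ?G = "\<lambda>q. poly (map_poly (\<lambda>p. fps_const (poly p 1)) q) \<phi>"
  have "degree (map_poly ?G (homogenization f)) \<le> total_degree f"
    by (rule degree_le) (auto simp: coeff_map_poly coeff_homogenization)
  then have "subst_puiseux f N \<phi> =
     (\<Sum>k\<le>total_degree f. ?G (coeff (homogenization f) k) * (fps_X ^ N) ^ k)"
    unfolding subst_puiseux_def
    by (subst poly_altdef, intro sum.mono_neutral_cong_left)
      (auto simp: coeff_map_poly intro!: le_degree)
  then show ?thesis
    by (simp add: dehom_part_def map_poly_map_poly o_def power_mult)
qed

lemma has_fps_expansion_poly:
  fixes \<phi> :: "complex fps"
  assumes "fps_conv_radius \<phi> > 0"
  shows "(\<lambda>s. poly p (eval_fps \<phi> s)) has_fps_expansion poly (map_poly fps_const p) \<phi>"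
proof (induction p rule: pCons_induct)
  case (pCons a p)
  then show ?case
    by (auto simp: map_poly_pCons intro!: fps_expansion_intros eval_fps_has_fps_expansion assms)
qed auto

text \<open>Bridge between formal and analytic solutions: the series vanishes exactly if the
  equation holds for all small s.\<close>

lemma subst_puiseux_has_fps_expansion:
  assumes "fps_conv_radius \<phi> > 0"
  shows "(\<lambda>s. eval3 (homogenization f) 1 (eval_fps \<phi> s) (s ^ N)) has_fps_expansion subst_puiseux f N \<phi>"
proof -
  have "(\<lambda>s. \<Sum>k\<le>total_degree f. poly (dehom_part f k) (eval_fps \<phi> s) * s ^ (N * k))
      has_fps_expansion subst_puiseux f N \<phi>"
    unfolding subst_puiseux_eq_sum
    by (intro fps_expansion_intros has_fps_expansion_poly assms)
  then show ?thesis
    by (simp add: poly_dehom_part eval3_homogenization coeff_homogenization power_mult)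
qed


section \<open>Conjugation of formal solutions and the ramification index\<close>

lemma map_poly_fps_const_mult: "map_poly fps_const (p * q) = map_poly fps_const p * map_poly fps_const q"
  for p q :: "complex poly"
  by (rule map_poly_hom_mult) auto

lemma map_poly_fps_const_add: "map_poly fps_const (p + q) = map_poly fps_const p + map_poly fps_const q"
  for p q :: "complex poly"
  by (rule poly_eqI) (simp add: coeff_map_poly)

lemma poly_map_poly_fps_const_pcompose:
  fixes p q :: "complex poly"
  shows "poly (map_poly fps_const (pcompose p q)) w =
         poly (map_poly fps_const p) (poly (map_poly fps_const q) w)"
proof (induction p rule: pCons_induct)
  case (pCons a p)
  then show ?case
    by (simp add: pcompose_pCons map_poly_fps_const_add map_poly_fps_const_mult map_poly_pCons)
qed auto

lemma poly_map_poly_fps_const_compose: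
  fixes w :: "complex fps"
  assumes "fps_nth L 0 = 0"
  shows "poly (map_poly fps_const p) (w oo L) = poly (map_poly fps_const p) w oo L"
proof (induction p rule: pCons_induct)
  case (pCons a p)
  then show ?case
    by (simp add: map_poly_pCons fps_compose_add_distrib fps_compose_mult_distrib[OF assms])
qed auto

text \<open>The substitution s -> c s fixes z = s^N and acts on series as a ring homomorphism, so it
  carries a solution to a conjugate solution.\<close>

lemma subst_puiseux_rotate:
  assumes "subst_puiseux f N \<phi> = 0" and "c ^ N = 1"
  shows "subst_puiseux f N (\<phi> oo (fps_const c * fps_X)) = 0"
proof -
  let ?L = "fps_const c * fps_X"
  have L0: "fps_nth ?L 0 = 0" by simp
  have "fps_X ^ (N * k) oo ?L = fps_X ^ (N * k)" for k
  proof -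
    have "fps_X ^ (N * k) oo ?L = ?L ^ (N * k)"
      by (simp add: fps_X_power_compose)
    also have "\<dots> = fps_X ^ (N * k)"
      using assms(2) by (simp add: power_mult_distrib power_mult)
    finally show ?thesis .
  qed
  then have "subst_puiseux f N (\<phi> oo ?L) = subst_puiseux f N \<phi> oo ?L"
    unfolding subst_puiseux_eq_sum poly_map_poly_fps_const_compose[OF L0]
      fps_compose_sum_distrib fps_compose_mult_distrib[OF L0] by simp
  with assms(1) show ?thesis by simp
qed

lemma fps_compose_linear_fixed:
  fixes \<phi> :: "complex fps"
  assumes "\<phi> oo (fps_const c * fps_X) = \<phi>" "fps_nth \<phi> k \<noteq> 0"
  shows "c ^ k = 1"
proof -
  have "fps_nth (\<phi> oo (fps_const c * fps_X)) k = c ^ k * fps_nth \<phi> k"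
    by (simp add: fps_compose_linear)
  with assms show ?thesis by simp
qed

text \<open>Modulo s the constant \<open>m\<close> is a simple root, so only one solution starts
  with \<open>m\<close>. Every conjugate of \<phi> thus equals \<phi>, all its exponents in s are
  multiples of \<open>N\<close>, and the gcd condition leaves N = 1.\<close>

lemma puiseux_unramified:
  assumes "puiseux_solution f m N \<phi>" and "poly (pderiv (dehom_part f 0)) m \<noteq> 0"
  shows "N = 1"
proof -
  from assms(1) have N: "N > 0" and m: "fps_nth \<phi> 0 = m"
    and gcd: "Gcd (insert N {k. fps_nth \<phi> k \<noteq> 0}) = 1" and sol: "subst_puiseux f N \<phi> = 0"
    by (auto simp: puiseux_solution_def)
  \<comment> \<open>The equation as a polynomial in y over the power series, so that
    \<open>pderiv\<close> differentiates in y.\<close>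
  define P where "P = (\<Sum>k\<le>total_degree f. smult (fps_X ^ (N * k)) (map_poly fps_const (dehom_part f k)))"
  have P: "poly P \<psi> = subst_puiseux f N \<psi>" for \<psi>
    by (simp add: P_def subst_puiseux_eq_sum poly_sum mult.commute)
  have "pderiv P = (\<Sum>k\<le>total_degree f. smult (fps_X ^ (N * k)) (map_poly fps_const (pderiv (dehom_part f k))))"
    by (simp add: P_def higher_pderiv_sum[of 1, simplified] pderiv_smult pderiv_map_poly_fps_const)
  then have "fps_nth (poly (pderiv P) \<phi>) 0 =
      (\<Sum>k\<le>total_degree f. fps_nth (fps_X ^ (N * k) * poly (map_poly fps_const (pderiv (dehom_part f k))) \<phi>) 0)"
    by (simp add: poly_sum fps_sum_nth)
  also have "\<dots> = (\<Sum>k\<le>total_degree f. if k = 0 then poly (pderiv (dehom_part f 0)) m else 0)"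
    using N by (intro sum.cong refl) (auto simp: poly_map_poly_fps_const_nth_0 m)
  finally have "fps_nth (poly (pderiv P) \<phi>) 0 =
      (\<Sum>k\<le>total_degree f. if k = 0 then poly (pderiv (dehom_part f 0)) m else 0)" .
  with assms(2) have der: "fps_nth (poly (pderiv P) \<phi>) 0 \<noteq> 0" by simp
  have "c ^ k = 1" if "c ^ N = 1" "fps_nth \<phi> k \<noteq> 0" for c :: complex and k
  proof -
    have "\<phi> = \<phi> oo (fps_const c * fps_X)"
      by (rule fps_poly_root_unique[OF _ _ _ der])
        (use sol subst_puiseux_rotate[OF sol that(1)] in \<open>auto simp: P\<close>)
    with that(2) show ?thesis by (metis fps_compose_linear_fixed)
  qed
  then have "\<forall>k \<in> insert N {k. fps_nth \<phi> k \<noteq> 0}. N dvd k"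
    using dvd_if_roots_unity[OF N] by auto
  then have "N dvd Gcd (insert N {k. fps_nth \<phi> k \<noteq> 0})" by (intro Gcd_greatest) auto
  with gcd show ?thesis by simp
qed

text \<open>
  If \<open>\<partial>F/\<partial>z\<close> does not vanish at \<open>(1:m:0)\<close>, then \<open>\<phi> = m + s\<^sup>l v\<close> with \<open>v(0) \<noteq> 0\<close> and \<open>N = e l\<close>, where \<open>e\<close>
  is the order of \<open>F(1, y, 0)\<close> at \<open>m\<close>. After division by \<open>s\<^sup>N\<close> the equation for \<open>v\<close> becomes,
  modulo \<open>s\<close>, \<open>u v\<^sup>e + F\<^sub>z(1,m,0) = 0\<close> with a constant \<open>u \<noteq> 0\<close>, so uniqueness in Hensel's lemma
  gives \<open>v(c s) = v(s)\<close> whenever \<open>c\<^sup>l = 1\<close>. Thus \<open>\<phi>\<close> is a series in \<open>s\<^sup>l\<close>, and \<open>l = 1\<close> by the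
  gcd condition.
\<close>

lemma puiseux_coeff_1_nonzero:
  assumes "puiseux_solution f m N \<phi>" and nz: "poly (dehom_part f 1) m \<noteq> 0"
  shows "fps_nth \<phi> 1 \<noteq> 0"
proof -
  from assms(1) have N: "N > 0" and m: "fps_nth \<phi> 0 = m"
    and gcd: "Gcd (insert N {k. fps_nth \<phi> k \<noteq> 0}) = 1" and sol: "subst_puiseux f N \<phi> = 0"
    by (auto simp: puiseux_solution_def)
  let ?c = "map_poly fps_const :: complex poly \<Rightarrow> _" and ?d = "total_degree f"
  \<comment> \<open>Recentring at y = m: \<open>p k\<close> is g_k(m + y).\<close>
  define p where "p k = pcompose (dehom_part f k) [:m, 1:]" for k
  \<comment> \<open>This puts k = 1, the term that carries F_z(1,m,0), into the range of the sum
    below.\<close>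
  have d: "?d \<ge> 1"
  proof (rule ccontr)
    assume "\<not> ?d \<ge> 1"
    then have "dehom_part f 1 = 0" by (simp add: dehom_part_def coeff_homogenization)
    with nz show False by simp
  qed
  have subst_shift: "subst_puiseux f N (fps_const m + w) = poly (?c (p 0)) w +
      fps_X ^ N * (\<Sum>k=1..?d. fps_X ^ (N * (k - 1)) * poly (?c (p k)) w)" for w
  proof -
    have "subst_puiseux f N (fps_const m + w) = (\<Sum>k\<le>?d. fps_X ^ (N * k) * poly (?c (p k)) w)"
      by (simp add: subst_puiseux_eq_sum p_def poly_map_poly_fps_const_pcompose map_poly_pCons mult.commute)
    also have "{..?d} = insert 0 {1..?d}" by auto
    also have "(\<Sum>k\<in>insert 0 {1..?d}. fps_X ^ (N * k) * poly (?c (p k)) w) =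
       poly (?c (p 0)) w + (\<Sum>k=1..?d. fps_X ^ (N * k) * poly (?c (p k)) w)"
      by simp
    also have "(\<Sum>k=1..?d. fps_X ^ (N * k) * poly (?c (p k)) w) =
        fps_X ^ N * (\<Sum>k=1..?d. fps_X ^ (N * (k - 1)) * poly (?c (p k)) w)"
    proof -
      have "N * k = N + N * (k - 1)" if "k \<in> {1..?d}" for k using that by (cases k) auto
      then show ?thesis
        unfolding sum_distrib_left
        by (intro sum.cong refl) (metis mult.assoc power_add)
    qed
    finally show ?thesis .
  qed

  define w where "w = \<phi> - fps_const m"
  have \<phi>: "\<phi> = fps_const m + w" and w0: "fps_nth w 0 = 0" by (simp_all add: w_def m)
  \<comment> \<open>The cofactor of s^N. Only k = 1 contributes to its constant term, which is
    F_z(1,m,0).\<close>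
  define R where "R = (\<Sum>k=1..?d. fps_X ^ (N * (k - 1)) * poly (?c (p k)) w)"
  have "fps_nth R 0 = (\<Sum>k=1..?d. if k = 1 then poly (p 1) 0 else 0)"
    unfolding R_def fps_sum_nth using N
    by (intro sum.cong refl) (auto simp: poly_map_poly_fps_const_nth_0 w0)
  with d nz have R0: "fps_nth R 0 \<noteq> 0" by (simp add: p_def poly_pcompose)
  then have [simp]: "R \<noteq> 0" by auto
  have eq: "poly (?c (p 0)) w = - (fps_X ^ N * R)"
    using sol subst_shift[of w] unfolding \<phi>[symmetric] R_def[symmetric]
    by (simp add: eq_neg_iff_add_eq_0)
  then have "p 0 \<noteq> 0" by auto
  define e where "e = order 0 (p 0)"
  obtain q where q: "p 0 = [:0, 1:] ^ e * q" and "\<not> [:0, 1:] dvd q"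
    using order_decomp[OF \<open>p 0 \<noteq> 0\<close>, of 0] by (auto simp: e_def)
  then have q0: "poly q 0 \<noteq> 0" using poly_eq_0_iff_dvd[of q 0] by simp
  have cX: "?c ([:0, 1:] ^ e) = [:0, 1:] ^ e"
    by (induction e) (simp_all only: power_Suc power_0 map_poly_fps_const_mult, simp_all add: map_poly_pCons map_poly_1)
  have p0: "poly (?c (p 0)) x = x ^ e * poly (?c q) x" for x
    by (simp add: q map_poly_fps_const_mult cX)
  have "fps_nth (poly (?c q) w) 0 \<noteq> 0"
    by (simp add: poly_map_poly_fps_const_nth_0 w0 q0)
  moreover have "w ^ e * poly (?c q) w \<noteq> 0"
    unfolding p0[symmetric] eq by simp
  \<comment> \<open>The factor q(w) is a unit, so this side has order e times that of w. Since
    \<open>R\<close> is a unit too, the other side has order exactly N.\<close>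
  ultimately have "subdegree (w ^ e * poly (?c q) w) = e * subdegree w"
    by (subst subdegree_mult) auto
  moreover have "subdegree (- (fps_X ^ N * R)) = N"
    using R0 by (simp add: fps_X_power_subdegree)
  ultimately have Nel: "N = e * subdegree w" using eq p0[of w] by simp
  define l where "l = subdegree w"
  have l: "l > 0" and e: "e > 0" using N Nel by (auto simp: l_def)
  \<comment> \<open>Positivity of l excludes w = 0, whose \<open>subdegree\<close> is 0 by
    convention.\<close>
  have wl: "fps_nth w l \<noteq> 0"
    using l by (auto simp: l_def)
  define v where "v = fps_shift l w"
  have wv: "w = fps_X ^ l * v"
    unfolding v_def l_def by (metis subdegree_decompose mult.commute)
  have v0: "fps_nth v 0 \<noteq> 0" using wl by (simp add: v_def)

  define S where "S = [:0, fps_X ^ l :: complex fps:]"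
  \<comment> \<open>\<open>S\<close> encodes y -> s^l y. In w^e q(w) the factor s^(e l) = s^N has
    been cancelled.\<close>
  define Q where "Q = [:0, 1:] ^ e * pcompose (?c q) S +
      (\<Sum>k=1..?d. smult (fps_X ^ (N * (k - 1))) (pcompose (?c (p k)) S))"
  have Q: "fps_X ^ N * poly Q y = subst_puiseux f N (fps_const m + fps_X ^ l * y)" for y
    unfolding subst_shift p0
    by (simp add: Q_def S_def poly_pcompose poly_sum Nel l_def power_mult power_mult_distrib
        algebra_simps flip: power_mult)
  have Q_root: "poly Q y = 0" if "subst_puiseux f N (fps_const m + fps_X ^ l * y) = 0" for y
    using that unfolding Q[symmetric] by simp
  have "fps_nth (poly (pderiv Q) v) 0 = of_nat e * fps_nth v 0 ^ (e - 1) * poly q 0"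
  proof -
    \<comment> \<open>By the chain rule this derivative carries the factor s^l. Modulo s only the
      derivative of y^e contributes to that of \<open>Q\<close>.\<close>
    have S': "fps_nth (poly (pderiv (pcompose r S)) v) 0 = 0" for r
      using l by (simp add: pderiv_pcompose S_def pderiv_pCons)
    have Sv: "poly S v = fps_X ^ l * v" by (simp add: S_def)
    have X': "pderiv ([:0, 1:] ^ e) = smult (of_nat e) ([:0, 1:] ^ (e - 1) :: complex fps poly)"
      by (simp add: pderiv_power pderiv_pCons)
    have "pderiv Q = [:0, 1:] ^ e * pderiv (pcompose (?c q) S) +
        pcompose (?c q) S * smult (of_nat e) ([:0, 1:] ^ (e - 1)) +
        (\<Sum>k=1..?d. smult (fps_X ^ (N * (k - 1))) (pderiv (pcompose (?c (p k)) S)))"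
      by (simp add: Q_def pderiv_add pderiv_mult X' higher_pderiv_sum[of 1, simplified] pderiv_smult)
    then show ?thesis
      using l
      by (simp add: poly_sum fps_sum_nth S' Sv poly_pcompose poly_map_poly_fps_const_nth_0 fps_power_zeroth zero_power)
  qed
  then have der: "fps_nth (poly (pderiv Q) v) 0 \<noteq> 0"
    using e v0 q0 by simp
  have "c ^ k = 1" if c: "c ^ l = 1" and k: "fps_nth \<phi> k \<noteq> 0" for c :: complex and k
  proof -
    let ?L = "fps_const c * fps_X"
    have L0: "fps_nth ?L 0 = 0" by simp
    have "fps_X ^ l oo ?L = fps_X ^ l"
      using c by (simp add: fps_X_power_compose power_mult_distrib)
    then have \<phi>': "\<phi> oo ?L = fps_const m + fps_X ^ l * (v oo ?L)"
      unfolding \<phi> wv fps_compose_add_distrib fps_compose_mult_distrib[OF L0] by simp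
    have "c ^ N = 1" using c by (simp add: Nel mult.commute[of e] power_mult flip: l_def)
    with sol have "subst_puiseux f N (\<phi> oo ?L) = 0" by (rule subst_puiseux_rotate)
    then have "v = v oo ?L"
      by (intro fps_poly_root_unique[OF _ _ _ der] Q_root) (use sol \<phi>' \<phi> wv in auto)
    then have "\<phi> oo ?L = \<phi>" unfolding \<phi>' using \<phi> wv by simp
    with k show ?thesis by (metis fps_compose_linear_fixed)
  qed
  then have "\<forall>k \<in> insert N {k. fps_nth \<phi> k \<noteq> 0}. l dvd k"
    using dvd_if_roots_unity[OF l] by (auto simp: Nel l_def)
  then have "l dvd Gcd (insert N {k. fps_nth \<phi> k \<noteq> 0})" by (intro Gcd_greatest) auto
  then have "l = 1" unfolding gcd by simp
  with wl show ?thesis by (simp add: w_def)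
qed

lemma regular_point_puiseux:
  assumes "regular_infinity_point f 1 m" "puiseux_solution f m N \<phi>"
  shows "N = 1 \<or> fps_nth \<phi> 1 \<noteq> 0"
proof -
  \<comment> \<open>Differentiation in y commutes with setting x = 1.\<close>
  have "pderiv (map_poly (\<lambda>p. poly p 1) g) = map_poly (\<lambda>p. poly p 1) (pderiv g)" for g :: "complex poly poly"
    by (rule poly_eqI) (simp add: coeff_pderiv coeff_map_poly)
  then have "poly (pderiv (dehom_part f 0)) m = eval2 (pderiv (hom_part f (total_degree f))) 1 m"
    by (simp add: dehom_part_def eval2_conv_map_poly coeff_homogenization)
  with assms(1) have "poly (pderiv (dehom_part f 0)) m \<noteq> 0 \<or> poly (dehom_part f 1) m \<noteq> 0"
    by (auto simp: regular_infinity_point_iff poly_dehom_part)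
  then show ?thesis
    using puiseux_unramified[OF assms(2)] puiseux_coeff_1_nonzero[OF assms(2)] by blast
qed

section \<open>The curve parametrized by a polynomial branch\<close>

lemma map_poly_hom_prod:
  fixes h :: "'a::comm_semiring_1 \<Rightarrow> 'b::comm_semiring_1"
  assumes "h 0 = 0" "h 1 = 1" "\<And>x y. h (x + y) = h x + h y" "\<And>x y. h (x * y) = h x * h y"
  shows "map_poly h (\<Prod>i\<in>A. p i) = (\<Prod>i\<in>A. map_poly h (p i))"
  by (induction A rule: infinite_finite_induct)
    (simp_all add: map_poly_hom_mult[of h] assms map_poly_1')

lemma map_poly_pcompose_mult:
  "map_poly (\<lambda>q. pcompose q r) (G * G') = map_poly (\<lambda>q. pcompose q r) G * map_poly (\<lambda>q. pcompose q r) G'"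
  for G G' :: "complex poly poly"
  by (rule map_poly_hom_mult) (simp_all add: pcompose_add pcompose_mult)

lemma map_poly_pcompose_prod:
  "map_poly (\<lambda>q. pcompose q r) (\<Prod>i\<in>A. G i) = (\<Prod>i\<in>A. map_poly (\<lambda>q. pcompose q r) (G i))"
  for G :: "'i \<Rightarrow> complex poly poly"
  by (rule map_poly_hom_prod) (simp_all add: pcompose_add pcompose_mult pcompose_1)

lemma coeff_pcompose_monom_mult:
  fixes q :: "complex poly"
  assumes "n > 0"
  shows "coeff (pcompose q (monom 1 n)) (n * i) = coeff q i"
proof (induction q arbitrary: i rule: pCons_induct)
  case (pCons a q)
  show ?case
  proof (cases i)
    case 0
    with assms show ?thesis by (simp add: pcompose_pCons coeff_monom_mult)
  next
    case (Suc k)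
    with assms pCons.IH[of k] show ?thesis
      by (simp add: pcompose_pCons coeff_monom_mult coeff_pCons split: nat.split)
  qed
qed auto

lemma pcompose_monom_inj:
  fixes q r :: "complex poly"
  assumes "n > 0" "pcompose q (monom 1 n) = pcompose r (monom 1 n)"
  shows "q = r"
  by (rule poly_eqI) (metis assms coeff_pcompose_monom_mult)

text \<open>If t^i occurs in q, comparing coefficients gives c^i = 1 for every n-th root of unity c,
  so n divides i.\<close>

lemma pcompose_monom_surj:
  fixes q :: "complex poly"
  assumes n: "n > 0" and inv: "\<And>c. c ^ n = 1 \<Longrightarrow> pcompose q [:0, c:] = q"
  shows "\<exists>r. pcompose r (monom 1 n) = q"
proof -
  have dvd: "n dvd i" if "coeff q i \<noteq> 0" for i
  proof (rule dvd_if_roots_unity[OF n])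
    fix c :: complex assume "c ^ n = 1"
    from inv[OF this] have "c ^ i * coeff q i = coeff q i"
      by (metis coeff_pcompose_linear)
    with that show "c ^ i = 1" by simp
  qed
  \<comment> \<open>The bound \<open>degree q\<close> is generous; terms with n * i beyond it
    vanish.\<close>
  define r where "r = (\<Sum>i\<le>degree q. monom (coeff q (n * i)) i)"
  have "poly (pcompose r (monom 1 n)) t = poly q t" for t
  proof -
    have "poly (pcompose r (monom 1 n)) t = (\<Sum>i\<le>degree q. coeff q (n * i) * t ^ (n * i))"
      by (simp add: r_def pcompose_sum poly_sum poly_pcompose poly_monom power_mult)
    also have "\<dots> = (\<Sum>i\<in>(\<lambda>i. n * i) ` {..degree q}. coeff q i * t ^ i)"
      using n by (subst sum.reindex) (auto simp: inj_on_def)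
    also have "\<dots> = (\<Sum>i\<le>degree q. coeff q i * t ^ i)"
    proof (rule sum.mono_neutral_cong)
      fix i assume "i \<in> {..degree q} - (\<lambda>i. n * i) ` {..degree q}"
      moreover have "i = n * (i div n)" "i div n \<le> i" if "n dvd i" using that by auto
      ultimately have "\<not> n dvd i" by (metis Diff_iff atMost_iff image_eqI order_trans)
      then show "coeff q i * t ^ i = 0" using dvd by auto
    qed (auto simp: coeff_eq_0)
    finally show ?thesis by (simp add: poly_altdef)
  qed
  then have "poly (pcompose r (monom 1 n)) = poly q" by blast
  then show ?thesis unfolding poly_eq_poly_eq_iff by blast
qed

lemma map_poly_pcompose_monom_surj:
  fixes G :: "complex poly poly"
  assumes n: "n > 0" and inv: "\<And>c. c ^ n = 1 \<Longrightarrow> map_poly (\<lambda>q. pcompose q [:0, c:]) G = G"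
  shows "\<exists>h. map_poly (\<lambda>q. pcompose q (monom 1 n)) h = G"
proof -
  have "\<exists>r. pcompose r (monom 1 n) = coeff G j" for j
    by (rule pcompose_monom_surj[OF n]) (metis inv coeff_map_poly pcompose_0)
  then obtain r where r: "\<And>j. pcompose (r j) (monom 1 n) = coeff G j" by metis
  \<comment> \<open>Cutting off at \<open>degree G\<close> loses nothing: beyond it injectivity
    forces \<open>r j = 0\<close>.\<close>
  have "coeff (\<Sum>j\<le>degree G. monom (r j) j) j = r j" for j
  proof (cases "j \<le> degree G")
    case False
    then have "pcompose (r j) (monom 1 n) = pcompose 0 (monom 1 n)" by (simp add: r coeff_eq_0)
    then have "r j = 0" by (rule pcompose_monom_inj[OF n])
    with False show ?thesis by (simp add: coeff_sum)
  qed (simp add: coeff_sum)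
  then have "map_poly (\<lambda>q. pcompose q (monom 1 n)) (\<Sum>j\<le>degree G. monom (r j) j) = G"
    by (intro poly_eqI) (simp add: coeff_map_poly r)
  then show ?thesis by blast
qed

text \<open>\<open>u j\<close> is the coefficient of s^j in a Puiseux series truncated after s^n =
  z. The second assumption is what regularity provides; it makes the n conjugates distinct.\<close>

locale polynomial_branch =
  fixes n :: nat and u :: "nat \<Rightarrow> complex"
  assumes n: "n > 0" and u: "n = 1 \<or> u 1 \<noteq> 0"
begin

definition \<rho> :: "complex poly" where "\<rho> = (\<Sum>j\<le>n. monom (u j) (n - j))"

definition \<psi> :: "complex poly" where "\<psi> = (\<Sum>j\<le>n. monom (u j) j)"

definition conj_prod :: "complex poly poly" where
  "conj_prod = (\<Prod>c\<in>{c. c ^ n = 1}. [:- pcompose \<rho> [:0, c:], 1:])"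

text \<open>The norm rewritten in x = t^n. The choice exists by \<open>map_poly_implicit\<close> and
  is unique, as \<open>pcompose_monom_inj\<close> applies to each coefficient.\<close>

definition implicit :: "complex poly poly" where
  "implicit = (SOME h. map_poly (\<lambda>q. pcompose q (monom 1 n)) h = conj_prod)"

lemma finite_roots: "finite {c :: complex. c ^ n = 1}"
  using n by (intro finite_roots_unity) auto

lemma root_nonzero: "c ^ n = 1 \<Longrightarrow> c \<noteq> (0 :: complex)"
  using n by (cases "c = 0") (simp_all add: zero_power)

lemma prod_roots_mult:
  assumes "c ^ n = 1"
  shows "(\<Prod>d\<in>{d :: complex. d ^ n = 1}. F (c * d)) = (\<Prod>d\<in>{d. d ^ n = 1}. F d)"
proof -
  have "c \<noteq> 0" using assms by (rule root_nonzero)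
  then show ?thesis
    by (intro prod.reindex_bij_witness[of _ "\<lambda>d. d / c" "\<lambda>d. c * d"])
      (auto simp: power_mult_distrib power_divide assms)
qed

text \<open>Replacing t by c t only permutes the factors, so the product is invariant and
  descends.\<close>

lemma map_poly_implicit: "map_poly (\<lambda>q. pcompose q (monom 1 n)) implicit = conj_prod"
proof -
  have "map_poly (\<lambda>q. pcompose q [:0, c:]) conj_prod = conj_prod" if "c ^ n = 1" for c
  proof -
    have "pcompose [:0, d:] [:0, c:] = [:0, c * d:]" for d :: complex
      by (simp add: pcompose_pCons)
    then have "map_poly (\<lambda>q. pcompose q [:0, c:]) conj_prod =
        (\<Prod>d\<in>{d. d ^ n = 1}. [:- pcompose \<rho> [:0, c * d:], 1:])"
      unfolding conj_prod_def map_poly_pcompose_prod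
      by (simp add: map_poly_pCons pcompose_uminus pcompose_1 flip: pcompose_assoc)
    also have "\<dots> = conj_prod"
      unfolding conj_prod_def by (rule prod_roots_mult[OF that])
    finally show ?thesis .
  qed
  then have "\<exists>h. map_poly (\<lambda>q. pcompose q (monom 1 n)) h = conj_prod"
    by (intro map_poly_pcompose_monom_surj n)
  then show ?thesis unfolding implicit_def by (rule someI_ex)
qed

lemma coeff_\<rho>: "coeff \<rho> i = (if i \<le> n then u (n - i) else 0)"
proof -
  have "coeff \<rho> i = (\<Sum>j\<le>n. if j = n - i then (if i \<le> n then u (n - i) else 0) else 0)"
    unfolding \<rho>_def coeff_sum by (intro sum.cong) auto
  then show ?thesis by simp
qed

lemma coeff_\<psi>: "coeff \<psi> j = (if j \<le> n then u j else 0)"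
  by (simp add: \<psi>_def coeff_sum)

lemma poly_\<rho>: "poly \<rho> t = (\<Sum>j\<le>n. u j * t ^ (n - j))"
  by (simp add: \<rho>_def poly_sum poly_monom)

lemma poly_\<rho>_inverse: "s \<noteq> 0 \<Longrightarrow> s ^ n * poly \<rho> (1 / s) = poly \<psi> s"
proof -
  assume s: "s \<noteq> 0"
  have *: "s ^ n * (u j * (1 / s) ^ (n - j)) = u j * s ^ j" if "j \<le> n" for j
  proof -
    have "s ^ n = s ^ j * s ^ (n - j)" using that by (simp flip: power_add)
    with s show ?thesis by (simp add: power_one_over)
  qed
  then show "s ^ n * poly \<rho> (1 / s) = poly \<psi> s"
    unfolding poly_\<rho> \<psi>_def poly_sum poly_monom sum_distrib_left by (intro sum.cong refl *) simp
qed

text \<open>The coefficient of t^(n-1) is c^(n-1) times \<open>u 1\<close>, and c^(n-1) = 1/c. For n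
  = 1 there is only one root of unity.\<close>

lemma inj_conjugates: "inj_on (\<lambda>c. pcompose \<rho> [:0, c:]) {c. c ^ n = 1}"
proof (rule inj_onI)
  fix c d :: complex
  assume c: "c \<in> {c. c ^ n = 1}" and d: "d \<in> {c. c ^ n = 1}" and "pcompose \<rho> [:0, c:] = pcompose \<rho> [:0, d:]"
  then have "c ^ (n - 1) * u 1 = d ^ (n - 1) * u 1"
    using n coeff_pcompose_linear[of \<rho> c "n - 1"] coeff_pcompose_linear[of \<rho> d "n - 1"] by (simp add: coeff_\<rho>)
  show "c = d"
  proof (cases "n = 1")
    case True
    with c d show ?thesis by simp
  next
    case False
    with u \<open>c ^ (n - 1) * u 1 = d ^ (n - 1) * u 1\<close> have "c ^ (n - 1) = d ^ (n - 1)" by auto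
    moreover have "x ^ (n - 1) * x = 1" if "x ^ n = 1" for x :: complex using that n by (cases n) (auto simp: mult.commute)
    ultimately have "c ^ (n - 1) * c = c ^ (n - 1) * d"
      using c d by (metis mem_Collect_eq)
    with c show ?thesis by (auto dest: root_nonzero)
  qed
qed

lemma degree_conj_prod: "degree conj_prod = n"
  unfolding conj_prod_def using n by (subst degree_prod_sum_eq) (auto simp: card_roots_unity_eq)

lemma lead_coeff_conj_prod: "lead_coeff conj_prod = 1"
  unfolding conj_prod_def lead_coeff_prod by simp

lemma degree_map_poly_pcompose_monom:
  "degree (map_poly (\<lambda>q :: complex poly. pcompose q (monom 1 n)) p) = degree p"
  using n by (intro degree_map_poly) (auto simp: pcompose_eq_0_iff degree_monom_eq)

lemma degree_implicit: "degree implicit = n"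
  using degree_conj_prod degree_map_poly_pcompose_monom[of implicit] by (simp add: map_poly_implicit)

lemma coeff_implicit: "coeff (coeff implicit j) i = coeff (coeff conj_prod j) (n * i)"
  by (simp add: coeff_map_poly coeff_pcompose_monom_mult n flip: map_poly_implicit)

lemma lead_coeff_implicit: "coeff implicit n = 1"
proof (rule pcompose_monom_inj[OF n])
  have "pcompose (coeff implicit n) (monom 1 n) = coeff conj_prod n"
    by (simp add: coeff_map_poly flip: map_poly_implicit)
  then show "pcompose (coeff implicit n) (monom 1 n) = pcompose 1 (monom 1 n)"
    using lead_coeff_conj_prod by (simp add: degree_conj_prod pcompose_1)
qed

lemma eval2_implicit: "eval2 implicit (t ^ n) y = (\<Prod>c\<in>{c. c ^ n = 1}. y - poly \<rho> (c * t))"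
proof -
  have "eval2 implicit (t ^ n) y = poly (map_poly (\<lambda>q. poly q t) conj_prod) y"
    unfolding eval2_conv_map_poly map_poly_implicit[symmetric]
    by (subst map_poly_map_poly) (auto simp: o_def poly_pcompose poly_monom)
  also have "map_poly (\<lambda>q. poly q t) conj_prod = (\<Prod>c\<in>{c. c ^ n = 1}. [:- poly \<rho> (c * t), 1:])"
    unfolding conj_prod_def
    by (subst map_poly_hom_prod) (simp_all add: map_poly_pCons poly_pcompose mult.commute)
  finally show ?thesis by (simp add: poly_prod)
qed

text \<open>A zero above x = t^n has y = \<rho>(c t) for some root of unity c, and c t is another
  parameter with the same x.\<close>

lemma zero_set_implicit: "zero_set implicit = range (\<lambda>t. (t ^ n, poly \<rho> t))"
proof safe
  fix x y assume "(x, y) \<in> zero_set implicit"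
  then have 0: "eval2 implicit x y = 0" by (simp add: zero_set_def)
  obtain t where t: "x = t ^ n" using n by (metis exists_complex_root neq0_conv)
  with 0 obtain c where c: "c ^ n = 1" "y = poly \<rho> (c * t)"
    by (auto simp: eval2_implicit finite_roots)
  then have "(x, y) = ((c * t) ^ n, poly \<rho> (c * t))" by (simp add: t power_mult_distrib)
  then show "(x, y) \<in> range (\<lambda>t. (t ^ n, poly \<rho> t))" by blast
next
  fix t
  have "eval2 implicit (t ^ n) (poly \<rho> t) = 0"
    unfolding eval2_implicit by (rule prod_zero[OF finite_roots]) (auto intro!: exI[of _ 1])
  then show "(t ^ n, poly \<rho> t) \<in> zero_set implicit" by (simp add: zero_set_def)
qed

text \<open>p(t^n, y) is unchanged by t -> c t, so the root \<rho> brings along all its conjugates,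
  which are n distinct roots.\<close>

lemma degree_ge_if_root:
  assumes "p \<noteq> 0" "poly (map_poly (\<lambda>q. pcompose q (monom 1 n)) p) \<rho> = 0"
  shows "degree p \<ge> n"
proof -
  let ?E = "map_poly (\<lambda>q. pcompose q (monom 1 n))"
  have "poly (?E p) (pcompose \<rho> [:0, c:]) = 0" if "c ^ n = 1" for c
  proof -
    have "pcompose (monom 1 n) [:0, c:] = monom 1 n"
      using that by (auto simp: poly_eq_iff coeff_pcompose_linear)
    then have "?E p = map_poly (\<lambda>q. pcompose q [:0, c:]) (?E p)"
      by (subst map_poly_map_poly) (simp_all add: o_def flip: pcompose_assoc)
    also have "poly \<dots> (pcompose \<rho> [:0, c:]) = pcompose (poly (?E p) \<rho>) [:0, c:]"
      by (rule poly_map_poly_hom) (simp_all add: pcompose_add pcompose_mult)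
    finally show ?thesis by (simp add: assms(2))
  qed
  then have sub: "(\<lambda>c. pcompose \<rho> [:0, c:]) ` {c. c ^ n = 1} \<subseteq> {y. poly (?E p) y = 0}" by auto
  have nz: "?E p \<noteq> 0"
    using assms(1) n by (subst map_poly_eq_0_iff) (auto simp: pcompose_eq_0_iff degree_monom_eq)
  have "n = card ((\<lambda>c. pcompose \<rho> [:0, c:]) ` {c. c ^ n = 1})"
    using n by (simp add: card_image[OF inj_conjugates] card_roots_unity_eq)
  also have "\<dots> \<le> card {y. poly (?E p) y = 0}"
    by (rule card_mono[OF poly_roots_finite[OF nz] sub])
  also have "\<dots> \<le> degree (?E p)" by (rule card_poly_roots_bound[OF nz])
  finally show ?thesis by (simp add: degree_map_poly_pcompose_monom)
qed

text \<open>One of the two factors has the root \<rho>, hence full degree n in y. The other is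
  constant in y and divides the leading coefficient 1.\<close>

lemma irreducible_implicit: "irreducible implicit"
proof (rule irreducibleI)
  show "implicit \<noteq> 0" using degree_implicit n by auto
  show "\<not> implicit dvd 1"
    using degree_implicit n by (auto simp: is_unit_poly_iff)
next
  fix p q assume pq: "implicit = p * q"
  have nz: "p \<noteq> 0" "q \<noteq> 0" using pq degree_implicit n by auto
  then have deg: "degree p + degree q = n" using pq degree_implicit by (simp add: degree_mult_eq)
  have lead: "lead_coeff p * lead_coeff q = 1"
    using lead_coeff_implicit degree_implicit pq lead_coeff_mult[of p q] by simp
  let ?E = "map_poly (\<lambda>q. pcompose q (monom 1 n))"
  have "poly conj_prod \<rho> = 0"
    unfolding conj_prod_def poly_prod
    by (rule prod_zero[OF finite_roots]) (auto intro!: exI[of _ 1])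
  then have "poly (?E p) \<rho> * poly (?E q) \<rho> = 0"
    by (simp add: pq map_poly_pcompose_mult flip: map_poly_implicit)
  then have "degree p \<ge> n \<or> degree q \<ge> n"
    using degree_ge_if_root nz by auto
  with deg have "degree q = 0 \<or> degree p = 0" by auto
  moreover have "r dvd 1" if "degree r = 0" "lead_coeff r dvd 1" for r :: "complex poly poly"
    using that by (auto simp: is_unit_poly_iff elim!: degree_eq_zeroE)
  ultimately show "p dvd 1 \<or> q dvd 1" using lead by (metis dvd_triv_left dvd_triv_right)
qed

text \<open>Give t weight 1 and y weight n. Each factor of the norm has weight at most n, so the
  product has weight at most n^2; since x = t^n, division by n bounds the degree, and y^n attains
  the bound.\<close>

lemma total_degree_implicit: "total_degree implicit = n"
proof (rule total_degree_eqI)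
  have deg\<rho>: "degree (pcompose \<rho> [:0, c:]) \<le> n" for c
    by (rule degree_le) (simp add: coeff_pcompose_linear coeff_\<rho>)
  have weight: "i + n * j \<le> n * card S"
    if "finite S" "coeff (coeff (\<Prod>c\<in>S. [:- pcompose \<rho> [:0, c:], 1:]) j) i \<noteq> 0" for S i j
    using that
  proof (induction S arbitrary: i j rule: finite_induct)
    case empty
    then show ?case by (cases j; cases i) (auto simp: coeff_1)
  next
    case (insert c S)
    let ?G = "\<Prod>c\<in>S. [:- pcompose \<rho> [:0, c:], 1:]" and ?l = "pcompose \<rho> [:0, c:]"
    \<comment> \<open>Multiplication by y - l turns the coefficient of y^j into -l G_j +
      G_(j-1).\<close>
    have "coeff (- ?l * coeff ?G j) i + coeff (coeff (pCons 0 ?G) j) i \<noteq> 0"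
      using insert by simp
    then consider "coeff (?l * coeff ?G j) i \<noteq> 0" | "coeff (coeff (pCons 0 ?G) j) i \<noteq> 0"
      by force
    then show ?case
    proof cases
      case 1
      then have "coeff ?G j \<noteq> 0" by auto
      then have IH: "degree (coeff ?G j) + n * j \<le> n * card S" by (intro insert.IH) simp
      have "i \<le> degree (?l * coeff ?G j)" using 1 by (rule le_degree)
      also have "\<dots> \<le> n + degree (coeff ?G j)"
        using degree_mult_le[of ?l] deg\<rho> by (meson add_mono order.refl order_trans)
      finally show ?thesis using IH insert by simp
    next
      case 2
      then obtain k where "j = Suc k" "coeff (coeff ?G k) i \<noteq> 0"
        by (cases j) auto
      with insert.IH[of k i] insert show ?thesis by simp
    qed
  qed
  fix i j assume "coeff (coeff implicit j) i \<noteq> 0"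
  then have "n * i + n * j \<le> n * n"
    using weight[OF finite_roots, of j "n * i"] n
    by (simp add: coeff_implicit card_roots_unity_eq flip: conj_prod_def)
  then show "i + j \<le> n" using n by (simp flip: add_mult_distrib2)
next
  show "coeff (coeff implicit n) 0 \<noteq> 0" by (simp add: lead_coeff_implicit)
qed simp

section \<open>The homogenized norm near the line at infinity\<close>

definition fibre :: "complex \<Rightarrow> complex poly" where
  "fibre y = (\<Sum>k\<le>n. monom (eval2 (coeff (homogenization implicit) k) 1 y) k)"

lemma poly_fibre: "poly (fibre y) z = eval3 (homogenization implicit) 1 y z"
  by (simp add: fibre_def eval3_homogenization poly_sum poly_monom coeff_homogenization total_degree_implicit)

text \<open>For s nonzero this is the affine product, with one factor s^n given to each of the n
  roots. As an identity of polynomials in s it also holds at s = 0 and allows comparison of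
  coefficients.\<close>

lemma fibre_eq: "pcompose (fibre y) (monom 1 n) = (\<Prod>c\<in>{c. c ^ n = 1}. [:y:] - pcompose \<psi> [:0, c:])"
  (is "?p = ?q")
proof -
  have "poly ?p s = poly ?q s" if s: "s \<noteq> 0" for s
  proof -
    have "poly ?p s = (s ^ n) ^ n * eval2 implicit (1 / s ^ n) (y / s ^ n)"
      using s by (simp add: poly_pcompose poly_monom poly_fibre eval3_homogenization_dehom total_degree_implicit)
    also have "\<dots> = (\<Prod>c\<in>{c :: complex. c ^ n = 1}. s ^ n) * (\<Prod>c\<in>{c. c ^ n = 1}. y / s ^ n - poly \<rho> (c * (1 / s)))"
      unfolding eval2_implicit[symmetric] using n by (simp add: power_one_over card_roots_unity_eq)
    also have "\<dots> = (\<Prod>c\<in>{c. c ^ n = 1}. s ^ n * (y / s ^ n - poly \<rho> (c * (1 / s))))"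
      by (simp add: prod.distrib)
    also have "\<dots> = (\<Prod>c\<in>{c. c ^ n = 1}. y - poly \<psi> (c * s))"
    \<comment> \<open>s^n \<rho>(c/s) is \<psi>(s/c), so the roots of unity are matched through c ->
      1/c.\<close>
    proof (rule prod.reindex_bij_witness[of _ "\<lambda>c. 1 / c" "\<lambda>c. 1 / c"])
      fix c :: complex assume "c \<in> {c. c ^ n = 1}"
      then have c: "c ^ n = 1" "c \<noteq> 0" using root_nonzero by auto
      have "poly \<psi> (1 / c * s) = s ^ n * poly \<rho> (c * (1 / s))"
        using poly_\<rho>_inverse[of "1 / c * s"] s c by (simp add: power_divide)
      then show "y - poly \<psi> (1 / c * s) = s ^ n * (y / s ^ n - poly \<rho> (c * (1 / s)))"
        using s by (simp add: right_diff_distrib)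
    qed (auto simp: power_one_over)
    also have "\<dots> = poly ?q s" by (simp add: poly_prod poly_pcompose mult.commute)
    finally show ?thesis .
  qed
  \<comment> \<open>The extra factor s makes the identity hold at s = 0 as well; it is then
    cancelled.\<close>
  then have "poly ([:0, 1:] * (?p - ?q)) s = 0" for s by (cases "s = 0") auto
  then have "[:0, 1:] * (?p - ?q) = 0" using poly_all_0_iff_0 by blast
  then show ?thesis by simp
qed

lemma eval3_implicit:
  "eval3 (homogenization implicit) 1 y (s ^ n) = (\<Prod>c\<in>{c. c ^ n = 1}. y - poly \<psi> (c * s))"
  using arg_cong[OF fibre_eq[of y], of "\<lambda>p. poly p s"]
  by (simp add: poly_pcompose poly_monom poly_fibre poly_prod mult.commute)

text \<open>At infinity the norm is (y - u_0)^n, a simple root for n = 1. For n > 1 the product at y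
  = u_0 starts with s^n = z, whose coefficient F_z is the product of all -(u_1 c), which is
  nonzero.\<close>

lemma regular_implicit: "regular_infinity_point implicit 1 (u 0)"
proof -
  have top: "eval2 (hom_part implicit n) 1 y = (y - u 0) ^ n" for y
    using eval3_implicit[of y 0] n
    by (simp add: eval3_at_0 coeff_homogenization total_degree_implicit poly_0_coeff_0 coeff_\<psi>
        power_0_left card_roots_unity_eq)
  show ?thesis
  proof (cases "n = 1")
    case True
    have "poly (map_poly (\<lambda>p. poly p 1) (hom_part implicit n)) = poly [:- u 0, 1:]"
      using True top by (auto simp: eval2_conv_map_poly)
    then have eq: "map_poly (\<lambda>p. poly p 1) (hom_part implicit n) = [:- u 0, 1:]"
      by (simp only: poly_eq_poly_eq_iff)
    have "map_poly (\<lambda>p. poly p 1) (pderiv (hom_part implicit n)) =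
        pderiv (map_poly (\<lambda>p. poly p 1) (hom_part implicit n))"
      by (rule poly_eqI) (simp add: coeff_pderiv coeff_map_poly)
    then have "eval2 (pderiv (hom_part implicit n)) 1 (u 0) = 1"
      by (simp add: eval2_conv_map_poly eq pderiv_pCons)
    then show ?thesis
      using n by (simp add: regular_infinity_point_iff total_degree_implicit top)
  next
    case False
    \<comment> \<open>\<open>\<theta> c\<close> is the quotient (u_0 - \<psi>(c s)) / s.\<close>
    define \<theta> where "\<theta> c = (\<Sum>j<n. monom (- (u (Suc j) * c ^ Suc j)) j)" for c
    have "[:u 0:] - pcompose \<psi> [:0, c:] = [:0, 1:] * \<theta> c" for c
    proof (rule poly_eqI)
      fix i
      show "coeff ([:u 0:] - pcompose \<psi> [:0, c:]) i = coeff ([:0, 1:] * \<theta> c) i"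
        by (cases i) (auto simp: coeff_pcompose_linear coeff_\<psi> poly_0_coeff_0 \<theta>_def coeff_sum)
    qed
    then have "pcompose (fibre (u 0)) (monom 1 n) = [:0, 1:] ^ n * (\<Prod>c\<in>{c. c ^ n = 1}. \<theta> c)"
      using n by (simp only: fibre_eq prod.distrib prod_constant card_roots_unity_eq)
    also have "[:0, 1:] ^ n = (monom 1 n :: complex poly)" by (simp add: monom_altdef)
    finally have "coeff (pcompose (fibre (u 0)) (monom 1 n)) (n * 1) = coeff (\<Prod>c\<in>{c. c ^ n = 1}. \<theta> c) 0"
      by (simp add: coeff_monom_mult)
    also have "\<dots> = (\<Prod>c\<in>{c. c ^ n = 1}. - (u 1 * c))"
      using n by (simp add: poly_prod \<theta>_def poly_sum poly_monom power_0_left if_distrib cong: if_cong flip: poly_0_coeff_0)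
    finally have "coeff (fibre (u 0)) 1 = (\<Prod>c\<in>{c. c ^ n = 1}. - (u 1 * c))"
      by (simp only: coeff_pcompose_monom_mult[OF n])
    moreover have "(\<Prod>c\<in>{c. c ^ n = 1}. - (u 1 * c)) \<noteq> 0"
      using False u by (auto simp: finite_roots dest: root_nonzero)
    moreover have "coeff (fibre (u 0)) 1 = eval2 (coeff (homogenization implicit) 1) 1 (u 0)"
      using n by (simp add: fibre_def coeff_sum)
    ultimately show ?thesis
      using n by (simp add: regular_infinity_point_iff total_degree_implicit top)
  qed
qed

text \<open>The factor with c = 1 vanishes at y = \<psi>(s).\<close>

lemma puiseux_implicit:
  assumes "Gcd (insert n {j. j \<le> n \<and> u j \<noteq> 0}) = 1"
  shows "puiseux_solution implicit (u 0) n (fps_of_poly \<psi>)"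
proof -
  have "{j. fps_nth (fps_of_poly \<psi>) j \<noteq> 0} = {j. j \<le> n \<and> u j \<noteq> 0}" by (auto simp: coeff_\<psi>)
  moreover have "subst_puiseux implicit n (fps_of_poly \<psi>) = 0"
  proof (rule fps_expansion_unique_complex)
    have "eval3 (homogenization implicit) 1 (eval_fps (fps_of_poly \<psi>) s) (s ^ n) = 0" for s
      unfolding eval3_implicit by (rule prod_zero[OF finite_roots]) (auto intro!: exI[of _ 1])
    then show "(\<lambda>s. 0) has_fps_expansion subst_puiseux implicit n (fps_of_poly \<psi>)"
      using subst_puiseux_has_fps_expansion[of "fps_of_poly \<psi>" implicit n] by simp
  qed simp
  ultimately show ?thesis
    using n assms by (simp add: puiseux_solution_def coeff_\<psi>)
qed

end

section \<open>Leaves at infinity\<close>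

lemma has_fps_expansion_eventually_eq:
  assumes "f has_fps_expansion F" "g has_fps_expansion F"
  shows "eventually (\<lambda>s. f s = g s) (nhds 0)"
  using assms unfolding has_fps_expansion_def by (auto elim: eventually_elim2)

lemma inverse_powr_tendsto_0:
  assumes "k > 0"
  shows "((\<lambda>z :: complex. inverse z powr (1 / of_nat k)) \<longlongrightarrow> 0) at_infinity"
proof (rule tendsto_powr_complex_0)
  show "(inverse \<longlongrightarrow> (0 :: complex)) at_infinity" by (rule tendsto_inverse_0)
  have "(1 :: complex) / of_nat k = of_real (1 / real k)" by simp
  then have "Re (1 / of_nat k) = 1 / real k" by (metis Re_complex_of_real)
  with assms show "0 < Re (1 / of_nat k)" by simp
qed (rule tendsto_const)

text \<open>Principal roots are compatible, so leaves of different ramification can be compared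
  through one common root.\<close>

lemma powr_inverse_mult_power:
  fixes w :: complex
  assumes "n > 0" "N > 0"
  shows "(w powr (1 / of_nat (n * N))) ^ n = w powr (1 / of_nat N)"
  using assms by (cases "w = 0") (simp_all add: powr_def field_simps zero_power flip: exp_of_nat_mult)

lemma eventually_at_infinity_nonzero: "eventually (\<lambda>z :: complex. z \<noteq> 0) at_infinity"
  unfolding eventually_at_infinity by (rule exI[of _ 1]) auto

text \<open>The series differ by a multiple of s^(n+1), and multiplication by z = s^(-n) leaves a
  factor s, which tends to 0.\<close>

lemma r_leaf_diff_tendsto_0:
  assumes n: "n > 0" and conv: "fps_conv_radius \<phi> > 0" "fps_conv_radius \<phi>' > 0"
    and agree: "\<And>j. j \<le> n \<Longrightarrow> fps_nth \<phi> j = fps_nth \<phi>' j"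
    and c: "c ^ n = 1"
  shows "((\<lambda>z. r_leaf n \<phi> c z - r_leaf n \<phi>' c z) \<longlongrightarrow> 0) at_infinity"
proof -
  define \<eta> where "\<eta> = fps_shift (Suc n) (\<phi> - \<phi>')"
  have diff: "\<phi> - \<phi>' = \<eta> * fps_X ^ Suc n"
    by (rule fps_ext) (auto simp: \<eta>_def fps_X_power_mult_right_nth agree simp del: power_Suc)
  have expansion: "(\<lambda>s. eval_fps \<phi> s - eval_fps \<phi>' s) has_fps_expansion (\<phi> - \<phi>')"
    by (intro fps_expansion_intros eval_fps_has_fps_expansion conv)
  then have "fps_conv_radius \<eta> > 0" by (simp add: \<eta>_def has_fps_expansion_def)
  then have \<eta>: "eval_fps \<eta> has_fps_expansion \<eta>" by (rule eval_fps_has_fps_expansion)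
  then have "(\<lambda>s. eval_fps \<eta> s * s ^ Suc n) has_fps_expansion (\<phi> - \<phi>')"
    unfolding diff by (intro fps_expansion_intros)
  with expansion have eq: "eventually (\<lambda>s. eval_fps \<phi> s - eval_fps \<phi>' s = eval_fps \<eta> s * s ^ Suc n) (nhds 0)"
    by (rule has_fps_expansion_eventually_eq)
  define \<sigma> where "\<sigma> z = c * inverse z powr (1 / of_nat n)" for z
  have \<sigma>: "(\<sigma> \<longlongrightarrow> 0) at_infinity"
    using tendsto_mult_left[OF inverse_powr_tendsto_0[OF n], of c] by (simp add: \<sigma>_def[abs_def])
  have \<sigma>_power: "\<sigma> z ^ n = inverse z" for z
    using powr_inverse_mult_power[of n 1 "inverse z"] n c by (simp add: \<sigma>_def power_mult_distrib)
  have "eventually (\<lambda>z. eval_fps \<eta> (\<sigma> z) * \<sigma> z = r_leaf n \<phi> c z - r_leaf n \<phi>' c z) at_infinity"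
    using eventually_compose_filterlim[OF eq \<sigma>] eventually_at_infinity_nonzero
  proof eventually_elim
    case (elim z)
    have "r_leaf n \<phi> c z - r_leaf n \<phi>' c z = z * (eval_fps \<phi> (\<sigma> z) - eval_fps \<phi>' (\<sigma> z))"
      by (simp add: r_leaf_def \<sigma>_def right_diff_distrib)
    also have "\<dots> = eval_fps \<eta> (\<sigma> z) * \<sigma> z * (z * \<sigma> z ^ n)" using elim by (simp add: mult_ac)
    finally show ?case using elim by (simp add: \<sigma>_power)
  qed
  moreover have "((\<lambda>z. eval_fps \<eta> (\<sigma> z) * \<sigma> z) \<longlongrightarrow> 0) at_infinity"
  proof -
    have "isCont (eval_fps \<eta>) 0" using has_fps_expansion_imp_continuous[OF \<eta>, of UNIV] by simp
    then have "((\<lambda>z. eval_fps \<eta> (\<sigma> z)) \<longlongrightarrow> eval_fps \<eta> 0) at_infinity"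
      using \<sigma> by (rule isCont_tendsto_compose)
    from tendsto_mult[OF this \<sigma>] show ?thesis by simp
  qed
  ultimately show ?thesis by (rule Lim_transform_eventually[rotated])
qed

text \<open>The distance to a set is 1-Lipschitz, and the two graph points differ only
  vertically.\<close>

lemma infdist_graph_tendsto_0:
  fixes r r' :: "complex \<Rightarrow> complex"
  assumes "((\<lambda>z. infdist (z, r z) D) \<longlongrightarrow> 0) F" "((\<lambda>z. r z - r' z) \<longlongrightarrow> 0) F"
  shows "((\<lambda>z. infdist (z, r' z) D) \<longlongrightarrow> 0) F"
proof (rule tendsto_sandwich[OF _ _ tendsto_const])
  show "eventually (\<lambda>z. 0 \<le> infdist (z, r' z) D) F" by (simp add: infdist_nonneg)
  have "infdist (z, r' z) D \<le> infdist (z, r z) D + norm (r z - r' z)" for z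
    using infdist_triangle[of "(z, r' z)" D "(z, r z)"]
    by (simp add: dist_Pair_Pair dist_norm norm_minus_commute)
  then show "eventually (\<lambda>z. infdist (z, r' z) D \<le> infdist (z, r z) D + norm (r z - r' z)) F"
    by simp
  show "((\<lambda>z. infdist (z, r z) D + norm (r z - r' z)) \<longlongrightarrow> 0) F"
    using tendsto_add[OF assms(1) tendsto_norm[OF assms(2)]] by simp
qed

lemma has_fps_expansion_eval_monom:
  fixes F :: "complex fps"
  assumes "fps_conv_radius F > 0" "k > 0"
  shows "(\<lambda>s. eval_fps F (c * s ^ k)) has_fps_expansion (F oo (fps_const c * fps_X ^ k))"
proof -
  have "(eval_fps F \<circ> (\<lambda>s. c * s ^ k)) has_fps_expansion (F oo (fps_const c * fps_X ^ k))"
    using assms(2)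
    by (intro has_fps_expansion_compose eval_fps_has_fps_expansion assms fps_expansion_intros) simp
  then show ?thesis by (simp add: o_def)
qed

text \<open>A branch may come from any defining polynomial and any ramification index. With s^(n N')
  in place of z all series become power series in s. The product of their differences vanishes, so
  one factor does.\<close>

lemma (in polynomial_branch) branch_leaf_eq:
  assumes sol: "puiseux_solution f' m' N' \<phi>'" and curve: "zero_set f' = range (\<lambda>t. (t ^ n, poly \<rho> t))"
    and c': "c' ^ N' = 1"
  shows "\<exists>c. c ^ n = 1 \<and> eventually (\<lambda>z. r_leaf N' \<phi>' c' z = r_leaf n (fps_of_poly \<psi>) c z) at_infinity"
proof -
  from sol have N': "N' > 0" and conv: "fps_conv_radius \<phi>' > 0" and "subst_puiseux f' N' \<phi>' = 0"
    by (auto simp: puiseux_solution_def)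
  then have "(\<lambda>s. eval3 (homogenization f') 1 (eval_fps \<phi>' s) (s ^ N')) has_fps_expansion 0"
    using subst_puiseux_has_fps_expansion[of \<phi>' f' N'] by simp
  then have ev: "eventually (\<lambda>s. eval3 (homogenization f') 1 (eval_fps \<phi>' s) (s ^ N') = 0) (nhds 0)"
    by (rule has_fps_expansion_eventually_eq) simp
  have lim: "((\<lambda>s. c' * s ^ n) \<longlongrightarrow> 0) (nhds 0)"
    by (rule tendsto_eq_intros refl filterlim_ident | use n in \<open>simp add: zero_power\<close>)+
  \<comment> \<open>The factor s covers s = 0, where dehomogenization would divide by 0; it is
    cancelled among the series.\<close>
  let ?P = "\<lambda>s. s * (\<Prod>c\<in>{c. c ^ n = 1}. eval_fps \<phi>' (c' * s ^ n) - eval_fps (fps_of_poly \<psi>) (c * s ^ N'))"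
  have "eventually (\<lambda>s. ?P s = 0) (nhds 0)"
    using eventually_compose_filterlim[OF ev lim]
  proof eventually_elim
    case (elim s)
    show ?case
    proof (cases "s = 0")
      case False
      then have nz: "(s ^ N') ^ n \<noteq> 0" by simp
      have "(c' * s ^ n) ^ N' = (s ^ N') ^ n"
        by (simp add: power_mult_distrib c' mult.commute flip: power_mult)
      with elim have "eval3 (homogenization f') 1 (eval_fps \<phi>' (c' * s ^ n)) ((s ^ N') ^ n) = 0"
        by simp
      \<comment> \<open>The two polynomials are compared only through their common zero set, off the
        line at infinity.\<close>
      with nz have "(1 / (s ^ N') ^ n, eval_fps \<phi>' (c' * s ^ n) / (s ^ N') ^ n) \<in> zero_set implicit"
        unfolding zero_set_implicit curve[symmetric]
        by (auto simp: eval3_homogenization_dehom zero_set_def)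
      with nz have "eval3 (homogenization implicit) 1 (eval_fps \<phi>' (c' * s ^ n)) ((s ^ N') ^ n) = 0"
        by (simp add: eval3_homogenization_dehom zero_set_def)
      then show ?thesis by (simp add: eval3_implicit)
    qed simp
  qed
  moreover have "?P has_fps_expansion fps_X * (\<Prod>c\<in>{c. c ^ n = 1}.
      (\<phi>' oo (fps_const c' * fps_X ^ n)) - (fps_of_poly \<psi> oo (fps_const c * fps_X ^ N')))"
    using n N' conv by (intro fps_expansion_intros has_fps_expansion_eval_monom) auto
  ultimately have "(\<lambda>s. 0) has_fps_expansion fps_X * (\<Prod>c\<in>{c. c ^ n = 1}.
      (\<phi>' oo (fps_const c' * fps_X ^ n)) - (fps_of_poly \<psi> oo (fps_const c * fps_X ^ N')))"
    by (subst (asm) has_fps_expansion_cong) auto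
  then have "fps_X * (\<Prod>c\<in>{c. c ^ n = 1}.
      (\<phi>' oo (fps_const c' * fps_X ^ n)) - (fps_of_poly \<psi> oo (fps_const c * fps_X ^ N'))) = 0"
    by (rule fps_expansion_unique_complex) simp
  then obtain c where c: "c ^ n = 1"
    and eq: "\<phi>' oo (fps_const c' * fps_X ^ n) = fps_of_poly \<psi> oo (fps_const c * fps_X ^ N')"
    by (auto simp: finite_roots)
  have ev': "eventually (\<lambda>s. eval_fps \<phi>' (c' * s ^ n) = eval_fps (fps_of_poly \<psi>) (c * s ^ N')) (nhds 0)"
    using has_fps_expansion_eval_monom[OF conv n, of c'] has_fps_expansion_eval_monom[of "fps_of_poly \<psi>" N' c] N'
    unfolding eq by (intro has_fps_expansion_eventually_eq) simp_all
  \<comment> \<open>For s the principal (n N')-th root of 1/z, the powers s^n and s^N' are the roots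
    used by the two leaves.\<close>
  have "n * N' > 0" using n N' by simp
  from eventually_compose_filterlim[OF ev' inverse_powr_tendsto_0[OF this]]
  have "eventually (\<lambda>z. r_leaf N' \<phi>' c' z = r_leaf n (fps_of_poly \<psi>) c z) at_infinity"
  proof eventually_elim
    case (elim z)
    have "(inverse z powr (1 / of_nat (n * N'))) ^ N' = inverse z powr (1 / of_nat n)"
      using powr_inverse_mult_power[OF N' n, of "inverse z"] by (simp add: mult.commute)
    with elim show ?case
      by (simp add: r_leaf_def powr_inverse_mult_power[OF n N'] del: of_nat_mult)
  qed
  with c show ?thesis by blast
qed

section \<open>The asymptotes of the branch\<close>

lemma r_coeff_nth:
  assumes "N > 0" shows "r_coeff N \<phi> (1 - of_nat j / of_nat N) = fps_nth \<phi> j"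
  using assms by (simp add: r_coeff_def)

text \<open>Each n_i/n carries a nonzero coefficient, hence lies in (1/N) times the naturals; so n
  divides every N n_i and, by the gcd, N. Conversely, if N > 1 the exponent 1/N occurs and equals
  some n_i/n, so N divides n.\<close>

lemma truncated_branch:
  fixes ns :: "nat \<Rightarrow> nat" and a :: "nat \<Rightarrow> complex"
  assumes N: "N > 0" and ram: "N = 1 \<or> fps_nth \<phi> 1 \<noteq> 0"
    and a_nz: "\<And>i. i \<in> {1..k} \<Longrightarrow> a i \<noteq> 0"
    and ns_bounds: "\<And>i. i \<in> {1..k} \<Longrightarrow> 0 < ns i \<and> ns i \<le> n"
    and ns_mono: "strict_mono_on {1..k} ns"
    and coprime: "Gcd (insert n (ns ` {1..k})) = 1"
    and expansion: "\<And>q :: rat. q \<ge> 0 \<Longrightarrow> r_coeff N \<phi> q =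
          (if q = 1 then m else 0)
          + (\<Sum>i = 1..k. if q = 1 - of_nat (ns i) / of_nat n then a i else 0)"
  shows "n = N" and "\<And>j. j \<le> n \<Longrightarrow>
      fps_nth \<phi> j = (if j = 0 then m else 0) + (\<Sum>i = 1..k. if j = ns i then a i else 0)"
proof -
  \<comment> \<open>For n = 0 the bounds leave no n_i, and \<open>Gcd {0}\<close> is 0.\<close>
  have n: "n > 0"
  proof (rule ccontr)
    assume "\<not> n > 0"
    then have "n = 0" by simp
    moreover from this have "k = 0" using ns_bounds[of 1] by (cases k) auto
    ultimately show False using coprime by simp
  qed
  have coeff: "fps_nth \<phi> j = (if j = 0 then m else 0) +
      (\<Sum>i = 1..k. if (of_nat j / of_nat N :: rat) = of_nat (ns i) / of_nat n then a i else 0)" if "j \<le> N" for j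
    using expansion[of "1 - of_nat j / of_nat N"] that N by (simp add: r_coeff_nth)
  have "n dvd N * x" if "x \<in> insert n (ns ` {1..k})" for x
  proof (cases "x = n")
    case False
    with that obtain i where i: "i \<in> {1..k}" "x = ns i" by auto
    let ?q = "1 - of_nat (ns i) / of_nat n :: rat"
    \<comment> \<open>Strict monotonicity makes the exponents distinct, so nothing cancels
      \<open>a i\<close>.\<close>
    have "(\<Sum>i' = 1..k. if ?q = 1 - of_nat (ns i') / of_nat n then a i' else 0) =
        (\<Sum>i' = 1..k. if i' = i then a i' else 0)"
      using i n strict_mono_on_imp_inj_on[OF ns_mono] by (intro sum.cong refl if_cong) (auto dest: inj_onD)
    also have "\<dots> = a i" using i by simp
    finally have "r_coeff N \<phi> ?q = a i"
      using expansion[of ?q] ns_bounds[OF i(1)] n by simp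
    with a_nz[OF i(1)] have "(1 - ?q) * of_nat N \<in> \<nat>" by (auto simp: r_coeff_def split: if_splits)
    then obtain p where "(1 - ?q) * of_nat N = of_nat p" by (auto elim: Nats_cases)
    then have "(of_nat (ns i * N) :: rat) = of_nat (p * n)" using n by (simp add: field_simps)
    then have "ns i * N = p * n" by (simp only: of_nat_eq_iff)
    then show ?thesis by (simp add: i mult.commute[of N])
  qed simp
  then have "n dvd Gcd ((*) N ` insert n (ns ` {1..k}))" by (intro Gcd_greatest) auto
  then have "n dvd N" by (simp only: Gcd_mult coprime) simp
  moreover have "N dvd n"
  proof (cases "N = 1")
    case False
    with ram N coeff[of 1] have "(\<Sum>i = 1..k. if (1 / of_nat N :: rat) = of_nat (ns i) / of_nat n then a i else 0) \<noteq> 0"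
      by simp
    then obtain i where "(1 / of_nat N :: rat) = of_nat (ns i) / of_nat n"
      by (elim sum.not_neutral_contains_not_neutral) (auto split: if_splits)
    then have "(of_nat n :: rat) = of_nat (N * ns i)" using n N by (simp add: field_simps)
    then have "n = N * ns i" by (simp only: of_nat_eq_iff)
    then show ?thesis by simp
  qed simp
  ultimately show nN: "n = N" by (rule dvd_antisym)
  show "fps_nth \<phi> j = (if j = 0 then m else 0) + (\<Sum>i = 1..k. if j = ns i then a i else 0)" if "j \<le> n" for j
    using coeff[of j] that N by (simp add: nN)
qed

theorem theorem5p6:
  fixes f :: "complex poly poly" and C Ct :: "(complex \<times> complex) set"
    and B :: "(complex \<Rightarrow> complex) set" and m :: complex
    and N :: nat and \<phi> :: "complex fps"
    and n k :: nat and ns :: "nat \<Rightarrow> nat" and a :: "nat \<Rightarrow> complex"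
  assumes curve: "defines_curve f C"
    and real_coeffs: "\<And>i j. coeff (coeff f j) i \<in> \<real>"
    and not_vertical: "\<not> infinity_point f 0 1"
    and regular: "regular_infinity_point f 1 m"
    and series: "puiseux_solution f m N \<phi>"
    and branch: "B = branch_of N \<phi>"
    and a_nz: "\<And>i. i \<in> {1..k} \<Longrightarrow> a i \<noteq> 0"
    and ns_bounds: "\<And>i. i \<in> {1..k} \<Longrightarrow> 0 < ns i \<and> ns i \<le> n"
    and ns_mono: "strict_mono_on {1..k} ns"
    and coprime: "Gcd (insert n (ns ` {1..k})) = 1"
    and expansion: "\<And>q :: rat. q \<ge> 0 \<Longrightarrow> r_coeff N \<phi> q =
          (if q = 1 then m else 0)
          + (\<Sum>i = 1..k. if q = 1 - of_nat (ns i) / of_nat n then a i else 0)"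
    and Ct: "Ct = range (\<lambda>t. (t ^ n, m * t ^ n + (\<Sum>i = 1..k. a i * t ^ (n - ns i))))"
  shows "(\<exists>h. defines_curve h Ct \<and> regular_infinity_point h 1 m)
       \<and> {D. asymptote D C B} = proximity_class Ct"
proof -
  from series have N: "N > 0" and \<phi>0: "fps_nth \<phi> 0 = m" and conv: "fps_conv_radius \<phi> > 0"
    by (auto simp: puiseux_solution_def)
  have ram: "N = 1 \<or> fps_nth \<phi> 1 \<noteq> 0" by (rule regular_point_puiseux[OF regular series])
  note trunc = truncated_branch[OF N ram a_nz ns_bounds ns_mono coprime expansion]
  have nN: "n = N" by (rule trunc(1))
  have \<phi>_coeff: "fps_nth \<phi> j = (if j = 0 then m else 0) + (\<Sum>i = 1..k. if j = ns i then a i else 0)"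
    if "j \<le> n" for j
    by (rule trunc(2)[OF _ _ _ that])
  \<comment> \<open>Only coefficients up to index n enter \<rho> and \<psi>; with n = N the fact
    \<open>ram\<close> supplies the second locale assumption.\<close>
  interpret polynomial_branch n "fps_nth \<phi>"
    by unfold_locales (use N ram nN in auto)
  have "poly \<rho> t = m * t ^ n + (\<Sum>i = 1..k. a i * t ^ (n - ns i))" for t
  proof -
    have "poly \<rho> t = (\<Sum>j\<le>n. (if j = 0 then m * t ^ n else 0) +
        (\<Sum>i = 1..k. if j = ns i then a i * t ^ (n - ns i) else 0))"
      unfolding poly_\<rho>
    proof (intro sum.cong refl)
      fix j assume "j \<in> {..n}"
      then have j: "j \<le> n" by simp
      have "(\<Sum>i = 1..k. if j = ns i then a i else 0) * t ^ (n - j) =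
          (\<Sum>i = 1..k. if j = ns i then a i * t ^ (n - ns i) else 0)"
        unfolding sum_distrib_right by (intro sum.cong refl) auto
      then show "fps_nth \<phi> j * t ^ (n - j) = (if j = 0 then m * t ^ n else 0) +
          (\<Sum>i = 1..k. if j = ns i then a i * t ^ (n - ns i) else 0)"
        unfolding \<phi>_coeff[OF j] distrib_right by auto
    qed
    also have "\<dots> = m * t ^ n + (\<Sum>i = 1..k. \<Sum>j\<le>n. if j = ns i then a i * t ^ (n - ns i) else 0)"
      unfolding sum.distrib by (subst (2) sum.swap) simp
    also have "(\<Sum>i = 1..k. \<Sum>j\<le>n. if j = ns i then a i * t ^ (n - ns i) else 0) =
        (\<Sum>i = 1..k. a i * t ^ (n - ns i))"
      using ns_bounds by (intro sum.cong refl) auto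
    finally show ?thesis .
  qed
  then have Ct': "Ct = range (\<lambda>t. (t ^ n, poly \<rho> t))" unfolding Ct by simp
  have curve_Ct: "defines_curve implicit Ct"
    by (simp add: defines_curve_def irreducible_implicit zero_set_implicit Ct')
  \<comment> \<open>Unless n = 1, the exponent 1 itself occurs.\<close>
  have "Gcd (insert n {j. j \<le> n \<and> fps_nth \<phi> j \<noteq> 0}) = 1"
  proof (cases "n = 1")
    case False
    then have "1 \<in> {j. j \<le> n \<and> fps_nth \<phi> j \<noteq> 0}" using n u by auto
    then have "Gcd (insert n {j. j \<le> n \<and> fps_nth \<phi> j \<noteq> 0}) dvd 1" by (intro Gcd_dvd) simp
    then show ?thesis by simp
  qed simp
  from puiseux_implicit[OF this] have branch_Ct: "infinity_branch Ct (branch_of n (fps_of_poly \<psi>))"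
    using curve_Ct by (auto simp: infinity_branch_def)
  have branch_C: "infinity_branch C B"
    using curve series branch by (auto simp: infinity_branch_def)
  have close: "((\<lambda>z. r_leaf N \<phi> c z - r_leaf n (fps_of_poly \<psi>) c z) \<longlongrightarrow> 0) at_infinity" if "c ^ n = 1" for c
    unfolding nN[symmetric] by (rule r_leaf_diff_tendsto_0[OF n conv]) (auto simp: coeff_\<psi> that)
  \<comment> \<open>Proved for every D, so perfectness enters both sides of the final equality
    unchanged.\<close>
  have "approaches_at D B \<longleftrightarrow> approaches D Ct" for D
  proof
    assume "approaches_at D B"
    then obtain c where c: "c ^ n = 1" "((\<lambda>z. infdist (z, r_leaf N \<phi> c z) D) \<longlongrightarrow> 0) at_infinity"
      by (auto simp: approaches_at_def branch branch_of_def nN)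
    from infdist_graph_tendsto_0[OF c(2) close[OF c(1)]]
    have "approaches_at D (branch_of n (fps_of_poly \<psi>))"
      using c(1) by (auto simp: approaches_at_def branch_of_def)
    with branch_Ct show "approaches D Ct" by (auto simp: approaches_def)
  next
    assume "approaches D Ct"
    then obtain f' m' N' \<phi>' c' where f': "defines_curve f' Ct" "puiseux_solution f' m' N' \<phi>'" "c' ^ N' = 1"
      and lim: "((\<lambda>z. infdist (z, r_leaf N' \<phi>' c' z) D) \<longlongrightarrow> 0) at_infinity"
      by (auto simp: approaches_def infinity_branch_def approaches_at_def branch_of_def)
    \<comment> \<open>The branch of \<open>Ct\<close> may come from any defining polynomial; its
      leaf is first matched with one of the given parametrization.\<close>
    from f'(1) have "zero_set f' = range (\<lambda>t. (t ^ n, poly \<rho> t))" by (simp add: defines_curve_def Ct')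
    from branch_leaf_eq[OF f'(2) this f'(3)] obtain c where c: "c ^ n = 1"
      and eq: "eventually (\<lambda>z. r_leaf N' \<phi>' c' z = r_leaf n (fps_of_poly \<psi>) c z) at_infinity"
      by blast
    have "((\<lambda>z. infdist (z, r_leaf n (fps_of_poly \<psi>) c z) D) \<longlongrightarrow> 0) at_infinity"
      by (rule Lim_transform_eventually[OF lim]) (use eq in eventually_elim, simp)
    moreover have "((\<lambda>z. r_leaf n (fps_of_poly \<psi>) c z - r_leaf N \<phi> c z) \<longlongrightarrow> 0) at_infinity"
      using tendsto_minus[OF close[OF c]] by simp
    ultimately have "((\<lambda>z. infdist (z, r_leaf N \<phi> c z) D) \<longlongrightarrow> 0) at_infinity"
      by (rule infdist_graph_tendsto_0)
    with c show "approaches_at D B" by (auto simp: approaches_at_def branch branch_of_def nN)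
  qed
  then have "{D. asymptote D C B} = proximity_class Ct"
    by (auto simp: asymptote_def proximity_class_def branch_C)
  moreover have "regular_infinity_point implicit 1 m"
    using regular_implicit by (simp add: \<phi>0)
  ultimately show ?thesis using curve_Ct by blast
qed

end
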